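(* Let $\nu$ be a complex number and let $\mu$ be a real number with $\mu<\frac32$. Then, for every $z\in\mathbb{R}$, the series below converges and $$D_{-\nu}(-z)D_{\mu-\nu-1}(z)=\frac{1}{\Gamma(\nu)}\sum_{n=0}^{+\infty}\frac{D_n(z)D_{\mu+n-1}(z)}{n!\,(n+\nu)}.$$
   Context: $D_\nu$ is the parabolic cylinder function, the entire function of $z\in\mathbb{C}$ (and of $\nu\in\mathbb{C}$) defined by $$D_\nu(z)=2^{\nu/2}e^{-z^2/4}\left(\frac{\sqrt{\pi}}{\Gamma(\frac12-\frac{\nu}{2})}\Phi\left(-\tfrac{\nu}{2},\tfrac12;\tfrac{z^2}{2}\right)-\frac{\sqrt{2\pi}\,z}{\Gamma(-\frac{\nu}{2})}\Phi\left(\tfrac12-\tfrac{\nu}{2},\tfrac32;\tfrac{z^2}{2}\right)\right),$$ with $1/\Gamma$ taken to be $0$ at the poles of $\Gamma$, where $\Phi(\nu,\mu;z)=\sum_{n=0}^{\infty}\frac{(\nu)_n}{(\mu)_n}\frac{z^n}{n!}$ is Kummer's confluent hypergeometric function and $(\nu)_n=\nu(\nu+1)\cdots(\nu+n-1)$. When $\nu$ is a nonpositive integer, each coefficient $\frac{1}{\Gamma(\nu)(n+\nu)}$ is read as its limiting value in $\nu$. *)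

theory Defs
  imports "HOL-Analysis.Analysis"
begin

definition kummer_Phi :: "complex \<Rightarrow> complex \<Rightarrow> complex \<Rightarrow> complex" where
  "kummer_Phi a b z = (\<Sum>n. pochhammer a n / pochhammer b n * z ^ n / fact n)"

text \<open>\<^const>\<open>rGamma\<close> is the entire function $1/\Gamma$, with value 0 at the poles of $\Gamma$.\<close>

definition parabolic_cylinder_D :: "complex \<Rightarrow> complex \<Rightarrow> complex" where
  "parabolic_cylinder_D \<nu> z =
     2 powr (\<nu> / 2) * exp (- (z\<^sup>2 / 4)) *
       (of_real (sqrt pi) * rGamma (1 / 2 - \<nu> / 2) * kummer_Phi (- (\<nu> / 2)) (1 / 2) (z\<^sup>2 / 2)
        - of_real (sqrt (2 * pi)) * z * rGamma (- (\<nu> / 2))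
            * kummer_Phi (1 / 2 - \<nu> / 2) (3 / 2) (z\<^sup>2 / 2))"

text \<open>
  The coefficient $1/(\Gamma(\nu)(n+\nu))$. When $\nu = -m$ is a nonpositive integer, the limit
  below exists: it is $(-1)^m m!$ for $n = m$ and $0$ for $n \neq m$.
\<close>

definition gamma_coeff :: "complex \<Rightarrow> nat \<Rightarrow> complex" where
  "gamma_coeff \<nu> n =
     (if \<nu> \<in> \<int>\<^sub>\<le>\<^sub>0 then Lim (at \<nu>) (\<lambda>w. rGamma w / (of_nat n + w))
      else rGamma \<nu> / (of_nat n + \<nu>))"

end

theory Submission
  imports Defs "HOL-Real_Asymp.Real_Asymp"
begin

text \<open>
  Write $P_n(\mu) = D_n(z) D_{\mu+n-1}(z) / n!$. The three-term recurrence of $D$ makes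
  $\mu P_n(\mu)$ a difference of consecutive terms of a null sequence if $\mu < 0$, so
  $\sum_n P_n(\mu) = 0$. Consequently $S(\nu,\mu) = \sum_n P_n(\mu)/(n+\nu)$ and
  $L(\nu,\mu) = \Gamma(\nu) D_{-\nu}(-z) D_{\mu-\nu-1}(z)$ satisfy the same contiguous
  relations and the same differentiation rule in $z$. These close to a linear system of four
  differential equations, whose solution is determined by its value at $z = 0$; there $S = L$ is
  Gauss's theorem for ${}_2F_1$ at $1$. This settles small $\mu$, and the recurrence in $\mu$
  reaches every $\mu < 2$, where the series still converges because
  $P_n(\mu) = O(n^{\mu/2-1+\varepsilon})$ by an energy estimate for the Weber equation.
  For $\nu$ a nonpositive integer only one coefficient is nonzero.
\<close>

section \<open>Power series and recurrences of the parabolic cylinder function\<close>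

text \<open>The two recurrences for the terms, divided by n + \<nu>, become relations between sums
  plus a leftover multiple of the sum of P_n; the vanishing of that sum is what makes the relations
  exact, and it forces the work to begin at small \<mu>. The four unknown functions arise by closing
  up differentiation. It leads from (\<nu>, \<mu>) to (\<nu>+1, \<mu>+1) and (\<nu>, \<mu>+1); the
  recurrence in \<mu> and the joint shift of both parameters bring everything back to (\<nu>,
  \<mu>), (\<nu>, \<mu>-1), (\<nu>+1, \<mu>+1), (\<nu>+1, \<mu>). The third of these needs its value
  at 0, which is available for \<mu>+1 < 0; hence the start at \<mu> < -1. In the energy estimate
  the weight a + 1/2 cancels the part of the Weber equation that grows with a. The Gronwall factor
  is then the same for all a, so the growth in n can be read off from the explicit values of D at
  0.\<close>

definition pcd0 :: "complex \<Rightarrow> complex" where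
  "pcd0 a = 2 powr (a / 2) * of_real (sqrt pi) * rGamma ((1 - a) / 2)"

text \<open>\<open>pcd0 a\<close> is D_a(0), and these are the Taylor coefficients at 0 of
  exp(z^2/4) D_a(z): differentiating that function lowers the index a by one and produces the factor
  a. In this form both the derivative rule and the recurrence become binomial identities.\<close>

definition pcd_coeff :: "complex \<Rightarrow> nat \<Rightarrow> complex" where
  "pcd_coeff a k = (a gchoose k) * pcd0 (a - of_nat k)"

text \<open>The functional equation of 1/Gamma, which has no exceptional points; hence no case
  distinction on a here or later.\<close>

lemma pcd0_plus1: "pcd0 (a + 1) = - a * pcd0 (a - 1)"
proof -
  have "pcd0 (a + 1) = 2 powr ((a - 1) / 2 + 1) * of_real (sqrt pi) * rGamma (- a / 2)"
    by (simp add: pcd0_def field_simps)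
  also have "rGamma (- a / 2) = (- a / 2) * rGamma ((1 - (a - 1)) / 2)"
    using rGamma_plus1[of "- a / 2"] by (simp add: field_simps)
  also have "2 powr ((a - 1) / 2 + 1) = 2 * (2::complex) powr ((a - 1) / 2)"
    by (simp add: powr_add)
  finally show ?thesis by (simp add: pcd0_def)
qed

text \<open>This is the coefficient form of y'' - z y' + a y = 0, the equation of exp(z^2/4) D_a(z).
  Steps of length two match the consecutive quotients of Kummer's series in z^2/2.\<close>

lemma pcd_coeff_Suc_Suc:
  "pcd_coeff a (Suc (Suc k)) =
     - (a - of_nat k) / (of_nat (Suc k) * of_nat (Suc (Suc k))) * pcd_coeff a k"
proof -
  have 1: "of_nat (Suc (Suc k)) * (a gchoose Suc (Suc k)) = (a - of_nat (Suc k)) * (a gchoose Suc k)"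
    using gbinomial_absorb_comp[of a "Suc k"] gbinomial_absorption[of "Suc k" a] by simp
  have 2: "of_nat (Suc k) * (a gchoose Suc k) = (a - of_nat k) * (a gchoose k)"
    using gbinomial_absorb_comp[of a k] gbinomial_absorption[of k a] by simp
  have 3: "pcd0 (a - of_nat k) = - (a - of_nat (Suc k)) * pcd0 (a - of_nat (Suc (Suc k)))"
    using pcd0_plus1[of "a - of_nat (Suc k)"] by (simp add: algebra_simps)
  have "of_nat (Suc k) * of_nat (Suc (Suc k)) * pcd_coeff a (Suc (Suc k)) =
      of_nat (Suc k) * (of_nat (Suc (Suc k)) * (a gchoose Suc (Suc k))) * pcd0 (a - of_nat (Suc (Suc k)))"
    by (simp add: pcd_coeff_def)
  also have "\<dots> = (of_nat (Suc k) * (a gchoose Suc k)) *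
      ((a - of_nat (Suc k)) * pcd0 (a - of_nat (Suc (Suc k))))"
    unfolding 1 by (simp only: ac_simps)
  also have "\<dots> = - (a - of_nat k) * pcd_coeff a k"
    unfolding 2 pcd_coeff_def 3 by (simp add: algebra_simps)
  finally show ?thesis
    by (simp add: field_simps del: of_nat_Suc)
qed

section \<open>Convergence of Kummer's series\<close>

lemma tendsto_inverse_Suc: "(\<lambda>n. 1 / complex_of_real (real (Suc n))) \<longlonglongrightarrow> 0"
  using LIMSEQ_inverse_real_of_nat[THEN tendsto_of_real[where 'a=complex]]
  by (simp add: inverse_eq_divide)

lemma tendsto_of_nat_plus_ratio:
  fixes c d :: complex
  shows "(\<lambda>n. (c + of_nat n) / (d + of_nat n)) \<longlonglongrightarrow> 1"
proof -
  have e: "1 + (b - 1) * (1 / complex_of_real (real (Suc n))) =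
      (b + of_nat n) / complex_of_real (real (Suc n))" for b n
    by (simp add: field_simps del: of_nat_Suc) simp
  have "(\<lambda>n. (1 + (c - 1) * (1 / complex_of_real (real (Suc n)))) /
      (1 + (d - 1) * (1 / complex_of_real (real (Suc n)))))
      \<longlonglongrightarrow> (1 + (c - 1) * 0) / (1 + (d - 1) * 0)"
    by (intro tendsto_intros tendsto_inverse_Suc) simp
  then show ?thesis unfolding e by (simp del: of_nat_Suc)
qed

lemma summable_kummer_Phi:
  fixes a b z :: complex
  assumes "b \<notin> \<int>\<^sub>\<le>\<^sub>0"
  shows "summable (\<lambda>n. pochhammer a n / pochhammer b n * z ^ n / fact n)"
proof -
  define f where "f = (\<lambda>n. pochhammer a n / pochhammer b n * z ^ n / fact n)"
  define r where "r = (\<lambda>n. (a + of_nat n) / (b + of_nat n) * z / of_nat (Suc n))"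
  have step: "f (Suc n) = r n * f n" for n
    by (simp add: f_def r_def pochhammer_Suc mult_ac)
  have "(\<lambda>n. (a + of_nat n) / (b + of_nat n) * (z * (1 / complex_of_real (real (Suc n))))) \<longlonglongrightarrow> 1 * (z * 0)"
    by (intro tendsto_intros tendsto_of_nat_plus_ratio tendsto_inverse_Suc)
  then have "r \<longlonglongrightarrow> 0" unfolding r_def by simp
  then have "(\<lambda>n. norm (r n)) \<longlonglongrightarrow> 0" by (rule tendsto_norm_zero)
  then have "eventually (\<lambda>n. norm (r n) < 1 / 2) sequentially"
    by (rule order_tendstoD) simp
  then obtain N where "\<And>n. n \<ge> N \<Longrightarrow> norm (r n) < 1 / 2"
    by (auto simp: eventually_sequentially)
  then have "norm (f (Suc n)) \<le> 1 / 2 * norm (f n)" if "n \<ge> N" for n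
    unfolding step norm_mult using that by (intro mult_right_mono) (auto intro: less_imp_le)
  then have "summable f" by (intro summable_ratio_test[of "1/2"]) auto
  then show ?thesis by (simp add: f_def)
qed

lemma half_notin_nonpos_Ints: "(1 / 2 :: complex) \<notin> \<int>\<^sub>\<le>\<^sub>0" "(3 / 2 :: complex) \<notin> \<int>\<^sub>\<le>\<^sub>0"
proof -
  have "complex_of_real (1 / 2) \<notin> \<int>\<^sub>\<le>\<^sub>0" "complex_of_real (3 / 2) \<notin> \<int>\<^sub>\<le>\<^sub>0"
    unfolding of_real_in_nonpos_Ints_iff by (auto dest: nonpos_Ints_nonpos)
  then show "(1 / 2 :: complex) \<notin> \<int>\<^sub>\<le>\<^sub>0" "(3 / 2 :: complex) \<notin> \<int>\<^sub>\<le>\<^sub>0" by simp_all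
qed

lemma pcd_coeff_even:
  "pcd_coeff a (2 * j) = pcd0 a * (pochhammer (- (a / 2)) j / pochhammer (1 / 2) j / (2 ^ j * fact j))"
proof (induction j)
  case 0
  show ?case by (simp add: pcd_coeff_def)
next
  case (Suc j)
  have ne: "(1 / 2 + of_nat j :: complex) \<noteq> 0"
    using half_notin_nonpos_Ints(1) by (metis minus_of_nat_in_nonpos_Ints add_eq_0_iff add.commute)
  have "pcd_coeff a (2 * Suc j) = - (a - of_nat (2 * j)) / (of_nat (Suc (2 * j)) * of_nat (Suc (Suc (2 * j))))
          * pcd_coeff a (2 * j)"
    using pcd_coeff_Suc_Suc[of a "2 * j"] by simp
  also have "- (a - of_nat (2 * j)) / (of_nat (Suc (2 * j)) * of_nat (Suc (Suc (2 * j)))) =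
      (- (a / 2) + of_nat j) / (1 / 2 + of_nat j) / (2 * of_nat (Suc j))"
  proof -
    have "of_nat (Suc (2 * j)) = 2 * (1 / 2 + of_nat j :: complex)" "of_nat (Suc (Suc (2 * j))) = (2 * of_nat (Suc j) :: complex)"
      "- (a - of_nat (2 * j)) = 2 * (- (a / 2) + of_nat j)"
      by (simp_all add: field_simps)
    then show ?thesis
      by (simp only: mult.assoc mult_divide_mult_cancel_left_if divide_divide_eq_left)
        (simp del: of_nat_Suc)
  qed
  finally show ?case unfolding Suc.IH by (simp add: pochhammer_Suc mult_ac del: of_nat_Suc)
qed

text \<open>The factor in front is the derivative at 0, namely a D_{a-1}(0) = - D_{a+1}(0) by
  \<open>pcd0_plus1\<close>.\<close>

lemma pcd_coeff_odd:
  "pcd_coeff a (Suc (2 * j)) = - pcd0 (a + 1) *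
     (pochhammer (1 / 2 - a / 2) j / pochhammer (3 / 2) j / (2 ^ j * fact j))"
proof (induction j)
  case 0
  show ?case using pcd0_plus1[of a] by (simp add: pcd_coeff_def)
next
  case (Suc j)
  have ne: "(3 / 2 + of_nat j :: complex) \<noteq> 0"
    using half_notin_nonpos_Ints(2) by (metis minus_of_nat_in_nonpos_Ints add_eq_0_iff add.commute)
  have "pcd_coeff a (Suc (2 * Suc j)) = - (a - of_nat (Suc (2 * j))) /
          (of_nat (Suc (Suc (2 * j))) * of_nat (Suc (Suc (Suc (2 * j))))) * pcd_coeff a (Suc (2 * j))"
    using pcd_coeff_Suc_Suc[of a "Suc (2 * j)"] by simp
  also have "- (a - of_nat (Suc (2 * j))) / (of_nat (Suc (Suc (2 * j))) * of_nat (Suc (Suc (Suc (2 * j))))) =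
      (1 / 2 - a / 2 + of_nat j) / (3 / 2 + of_nat j) / (2 * of_nat (Suc j))"
  proof -
    have "of_nat (Suc (Suc (Suc (2 * j)))) = 2 * (3 / 2 + of_nat j :: complex)" "of_nat (Suc (Suc (2 * j))) = (2 * of_nat (Suc j) :: complex)"
      "- (a - of_nat (Suc (2 * j))) = 2 * (1 / 2 - a / 2 + of_nat j)"
      by (simp_all add: field_simps)
    then show ?thesis
      by (simp only: mult.assoc mult_divide_mult_cancel_left_if divide_divide_eq_left)
        (simp del: of_nat_Suc)
  qed
  finally show ?case unfolding Suc.IH by (simp add: pochhammer_Suc mult_ac del: of_nat_Suc)
qed

lemma parabolic_cylinder_D_altdef:
  "exp (z\<^sup>2 / 4) * parabolic_cylinder_D a z =
     pcd0 a * kummer_Phi (- (a / 2)) (1 / 2) (z\<^sup>2 / 2)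
     - pcd0 (a + 1) * z * kummer_Phi (1 / 2 - a / 2) (3 / 2) (z\<^sup>2 / 2)"
proof -
  \<comment> \<open>This absorbs the sqrt 2 that distinguishes the coefficient sqrt(2 pi) of the
    second Kummer term from sqrt pi in the first.\<close>
  have "2 powr ((a + 1) / 2) = of_real (sqrt 2) * (2 powr (a / 2) :: complex)"
  proof -
    have "2 powr (1 / 2 :: complex) = of_real (sqrt 2)"
      by (simp add: csqrt_conv_powr[symmetric])
    then show ?thesis by (simp add: add_divide_distrib powr_add)
  qed
  then have odd: "2 powr (a / 2) * (of_real (sqrt (2 * pi)) * rGamma (- (a / 2))) = pcd0 (a + 1)"
    by (simp add: pcd0_def real_sqrt_mult)
  have even: "2 powr (a / 2) * (of_real (sqrt pi) * rGamma (1 / 2 - a / 2)) = pcd0 a"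
    by (simp add: pcd0_def diff_divide_distrib)
  have "exp (z\<^sup>2 / 4) * parabolic_cylinder_D a z = 2 powr (a / 2) *
       (of_real (sqrt pi) * rGamma (1 / 2 - a / 2) * kummer_Phi (- (a / 2)) (1 / 2) (z\<^sup>2 / 2)
        - of_real (sqrt (2 * pi)) * z * rGamma (- (a / 2))
            * kummer_Phi (1 / 2 - a / 2) (3 / 2) (z\<^sup>2 / 2))"
    by (simp add: parabolic_cylinder_D_def exp_minus)
  also have "\<dots> = (2 powr (a / 2) * (of_real (sqrt pi) * rGamma (1 / 2 - a / 2))) * kummer_Phi (- (a / 2)) (1 / 2) (z\<^sup>2 / 2)
     - (2 powr (a / 2) * (of_real (sqrt (2 * pi)) * rGamma (- (a / 2)))) * z * kummer_Phi (1 / 2 - a / 2) (3 / 2) (z\<^sup>2 / 2)"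
    by (simp only: right_diff_distrib ac_simps)
  finally show ?thesis unfolding odd even .
qed

lemma pcd_coeff_sums:
  "(\<lambda>k. pcd_coeff a k * z ^ k) sums (exp (z\<^sup>2 / 4) * parabolic_cylinder_D a z)"
proof -
  let ?f = "\<lambda>k. pcd_coeff a k * z ^ k"
  have K: "(\<lambda>n. pochhammer c n / pochhammer b n * (z\<^sup>2 / 2) ^ n / fact n) sums kummer_Phi c b (z\<^sup>2 / 2)"
    if "b \<notin> \<int>\<^sub>\<le>\<^sub>0" for b c
    unfolding kummer_Phi_def using summable_kummer_Phi[OF that] by (rule summable_sums)
  have "(\<lambda>j. pcd0 a * (pochhammer (- (a / 2)) j / pochhammer (1 / 2) j * (z\<^sup>2 / 2) ^ j / fact j))
     sums (pcd0 a * kummer_Phi (- (a / 2)) (1 / 2) (z\<^sup>2 / 2))"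
    by (intro sums_mult K half_notin_nonpos_Ints)
  also have "(\<lambda>j. pcd0 a * (pochhammer (- (a / 2)) j / pochhammer (1 / 2) j * (z\<^sup>2 / 2) ^ j / fact j))
      = (\<lambda>j. (\<lambda>k. if even k then ?f k else 0) (2 * j))"
    unfolding pcd_coeff_even power_mult power_divide by (simp add: mult_ac)
  finally have even: "(\<lambda>k. if even k then ?f k else 0) sums (pcd0 a * kummer_Phi (- (a / 2)) (1 / 2) (z\<^sup>2 / 2))"
    \<comment> \<open>Padding with zeros at the other parity lets the even and the odd series be
      added index by index.\<close>
    by (subst (asm) sums_mono_reindex) (auto simp: strict_mono_def elim!: evenE)
  have "(\<lambda>j. - pcd0 (a + 1) * z * (pochhammer (1 / 2 - a / 2) j / pochhammer (3 / 2) j * (z\<^sup>2 / 2) ^ j / fact j))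
     sums (- pcd0 (a + 1) * z * kummer_Phi (1 / 2 - a / 2) (3 / 2) (z\<^sup>2 / 2))"
    by (intro sums_mult K half_notin_nonpos_Ints)
  also have "(\<lambda>j. - pcd0 (a + 1) * z * (pochhammer (1 / 2 - a / 2) j / pochhammer (3 / 2) j * (z\<^sup>2 / 2) ^ j / fact j))
      = (\<lambda>j. (\<lambda>k. if odd k then ?f k else 0) (Suc (2 * j)))"
    unfolding pcd_coeff_odd power_mult power_divide power_Suc by (simp add: power_mult mult_ac)
  finally have odd: "(\<lambda>k. if odd k then ?f k else 0) sums (- pcd0 (a + 1) * z * kummer_Phi (1 / 2 - a / 2) (3 / 2) (z\<^sup>2 / 2))"
    by (subst (asm) sums_mono_reindex) (auto simp: strict_mono_def elim!: oddE)
  have "(\<lambda>k. (if even k then ?f k else 0) + (if odd k then ?f k else 0)) = ?f" by auto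
  with sums_add[OF even odd] show ?thesis
    unfolding parabolic_cylinder_D_altdef by simp
qed

lemma parabolic_cylinder_D_at_0 [simp]: "parabolic_cylinder_D a 0 = pcd0 a"
  using pcd_coeff_sums[of a 0] sums_unique2[OF _ powser_sums_zero[of "pcd_coeff a"]]
  by (fastforce simp: pcd_coeff_def)

lemma diffs_pcd_coeff: "diffs (pcd_coeff a) k = a * pcd_coeff (a - 1) k"
proof -
  have "diffs (pcd_coeff a) k = of_nat (Suc k) * (a gchoose Suc k) * pcd0 (a - of_nat (Suc k))"
    by (simp add: diffs_def pcd_coeff_def)
  also have "\<dots> = a * ((a - 1) gchoose k) * pcd0 (a - 1 - of_nat k)"
    unfolding gbinomial_absorption by (simp add: algebra_simps)
  finally show ?thesis by (simp add: pcd_coeff_def)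
qed

lemma has_field_derivative_parabolic_cylinder_D:
  "(parabolic_cylinder_D a has_field_derivative
     (a * parabolic_cylinder_D (a - 1) z - z / 2 * parabolic_cylinder_D a z)) (at z)"
proof -
  have D: "parabolic_cylinder_D b w = exp (- (w\<^sup>2 / 4)) * (\<Sum>k. pcd_coeff b k * w ^ k)" for b w
    using pcd_coeff_sums[of b w, THEN sums_unique] by (simp add: exp_minus field_simps)
  have "((\<lambda>w. \<Sum>k. pcd_coeff a k * w ^ k) has_field_derivative (\<Sum>k. diffs (pcd_coeff a) k * z ^ k)) (at z)"
    by (rule termdiffs_strong_converges_everywhere) (rule sums_summable[OF pcd_coeff_sums])
  also have "(\<Sum>k. diffs (pcd_coeff a) k * z ^ k) = a * (\<Sum>k. pcd_coeff (a - 1) k * z ^ k)"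
    unfolding diffs_pcd_coeff mult.assoc
    by (rule suminf_mult) (rule sums_summable[OF pcd_coeff_sums])
  finally have "((\<lambda>w. exp (- (w\<^sup>2 / 4)) * (\<Sum>k. pcd_coeff a k * w ^ k)) has_field_derivative
     (a * parabolic_cylinder_D (a - 1) z - z / 2 * parabolic_cylinder_D a z)) (at z)"
    unfolding D by (auto intro!: derivative_eq_intros simp: field_simps)
  then show ?thesis unfolding D[abs_def] .
qed

text \<open>Pascal's rule splits the coefficient of index a + 1 in two: one part is a shifted
  coefficient of index a, the other is turned into index a - 1 by absorption and
  \<open>pcd0_plus1\<close>.\<close>

lemma parabolic_cylinder_D_plus1:
  "parabolic_cylinder_D (a + 1) z = z * parabolic_cylinder_D a z - a * parabolic_cylinder_D (a - 1) z"
proof -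
  let ?E = "exp (z\<^sup>2 / 4)"
  let ?g = "\<lambda>k. case k of 0 \<Rightarrow> 0 | Suc k \<Rightarrow> pcd_coeff a k * z ^ Suc k"
  have coeff: "pcd_coeff (a + 1) k * z ^ k = ?g k - a * (pcd_coeff (a - 1) k * z ^ k)" for k
  proof (cases k)
    case 0
    then show ?thesis using pcd0_plus1[of a] by (simp add: pcd_coeff_def)
  next
    case (Suc j)
    have "of_nat (Suc k) * (a gchoose Suc k) = (a - of_nat k) * (a gchoose k)"
      using gbinomial_absorb_comp[of a k] gbinomial_absorption[of k a] by simp
    moreover have "a * pcd_coeff (a - 1) k = (of_nat (Suc k) * (a gchoose Suc k)) * pcd0 (a - of_nat k - 1)"
      unfolding diffs_pcd_coeff[symmetric] by (simp add: diffs_def pcd_coeff_def diff_diff_eq add.commute mult.assoc)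
    ultimately have "a * pcd_coeff (a - 1) k = (a gchoose k) * ((a - of_nat k) * pcd0 (a - of_nat k - 1))"
      by (simp only: ac_simps)
    also have "(a - of_nat k) * pcd0 (a - of_nat k - 1) = - pcd0 (a - of_nat k + 1)"
      using pcd0_plus1[of "a - of_nat k"] by (simp add: algebra_simps)
    finally have step: "pcd_coeff (a + 1) k = pcd_coeff a j - a * pcd_coeff (a - 1) k"
      using gbinomial_Suc_Suc[of a j] unfolding Suc
      by (simp add: pcd_coeff_def distrib_right del: gbinomial_Suc)
    show ?thesis unfolding step unfolding Suc by (simp add: algebra_simps)
  qed
  have "?g sums (z * (?E * parabolic_cylinder_D a z))"
    using sums_mult[OF pcd_coeff_sums[of a z], of z]
    by (subst sums_Suc_iff[of ?g, symmetric, where s="z * (?E * parabolic_cylinder_D a z)", simplified])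
       (simp add: mult_ac)
  then have "(\<lambda>k. ?g k - a * (pcd_coeff (a - 1) k * z ^ k)) sums
      (z * (?E * parabolic_cylinder_D a z) - a * (?E * parabolic_cylinder_D (a - 1) z))"
    by (intro sums_diff sums_mult pcd_coeff_sums)
  then have "?E * parabolic_cylinder_D (a + 1) z =
      z * (?E * parabolic_cylinder_D a z) - a * (?E * parabolic_cylinder_D (a - 1) z)"
    unfolding coeff[symmetric] using pcd_coeff_sums sums_unique2 by blast
  also have "\<dots> = ?E * (z * parabolic_cylinder_D a z - a * parabolic_cylinder_D (a - 1) z)"
    by (simp add: algebra_simps)
  finally show ?thesis by simp
qed

section \<open>Growth in the parameter\<close>

text \<open>The function f(s) exp(-K s) is nonincreasing.\<close>

lemma gronwall_right:
  fixes f f' :: "real \<Rightarrow> real"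
  assumes "\<And>s. 0 \<le> s \<Longrightarrow> s \<le> t \<Longrightarrow> (f has_real_derivative f' s) (at s)"
    and "\<And>s. 0 \<le> s \<Longrightarrow> s \<le> t \<Longrightarrow> f' s \<le> K * f s" and "0 \<le> t"
  shows "f t \<le> f 0 * exp (K * t)"
proof -
  have "f t * exp (- K * t) \<le> f 0 * exp (- K * 0)"
  proof (rule DERIV_nonpos_imp_nonincreasing[OF \<open>0 \<le> t\<close>])
    fix s assume s: "0 \<le> s" "s \<le> t"
    have "((\<lambda>s. f s * exp (- K * s)) has_real_derivative (f' s - K * f s) * exp (- K * s)) (at s)"
      by (auto intro!: derivative_eq_intros assms(1) s simp: algebra_simps)
    moreover have "(f' s - K * f s) * exp (- K * s) \<le> 0"
      using assms(2)[OF s] by (simp add: mult_nonpos_nonneg)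
    ultimately show "\<exists>y. ((\<lambda>s. f s * exp (- K * s)) has_real_derivative y) (at s) \<and> y \<le> 0" by blast
  qed
  then show ?thesis by (simp add: exp_minus field_simps)
qed

text \<open>Negative t is handled by reflection; the bound on the absolute value of f' is what makes
  the hypothesis symmetric.\<close>

lemma gronwall_abs:
  fixes f f' :: "real \<Rightarrow> real"
  assumes "\<And>s. \<bar>s\<bar> \<le> Z \<Longrightarrow> (f has_real_derivative f' s) (at s)"
    and "\<And>s. \<bar>s\<bar> \<le> Z \<Longrightarrow> \<bar>f' s\<bar> \<le> K * f s" and "\<bar>t\<bar> \<le> Z"
  shows "f t \<le> f 0 * exp (K * \<bar>t\<bar>)"
proof (cases "0 \<le> t")
  case True
  with gronwall_right[of t f f' K] assms show ?thesis by (fastforce simp: abs_le_iff)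
next
  case False
  have "(\<lambda>s. f (- s)) (- t) \<le> (\<lambda>s. f (- s)) 0 * exp (K * (- t))"
  proof (rule gronwall_right)
    fix s assume "0 \<le> s" "s \<le> - t"
    with assms(3) have s: "\<bar>- s\<bar> \<le> Z" by simp
    show "((\<lambda>s. f (- s)) has_real_derivative - f' (- s)) (at s)"
      using assms(1)[OF s] by (simp add: DERIV_mirror)
    show "- f' (- s) \<le> K * f (- s)" using assms(2)[OF s] by simp
  qed (use False in simp)
  with False show ?thesis by simp
qed

lemma has_vector_derivative_parabolic_cylinder_D:
  "((\<lambda>t. parabolic_cylinder_D a (of_real t)) has_vector_derivative
     (a * parabolic_cylinder_D (a - 1) (of_real t)
      - of_real t / 2 * parabolic_cylinder_D a (of_real t))) (at t within S)"
  by (intro has_vector_derivative_real_field has_field_derivative_parabolic_cylinder_D)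

lemma has_real_derivative_norm_square:
  fixes f :: "real \<Rightarrow> 'a::real_inner"
  assumes "(f has_vector_derivative f') (at t within S)"
  shows "((\<lambda>t. (norm (f t))\<^sup>2) has_real_derivative 2 * (f t \<bullet> f')) (at t within S)"
proof -
  have "((\<lambda>t. f t \<bullet> f t) has_vector_derivative (f t \<bullet> f' + f' \<bullet> f t)) (at t within S)"
    by (rule bounded_bilinear.has_vector_derivative[OF bounded_bilinear_inner assms assms])
  then show ?thesis
    by (simp add: power2_norm_eq_inner has_real_derivative_iff_has_vector_derivative inner_commute)
qed

text \<open>The energy |y'|^2 + (a + 1/2) |y|^2 of y = D_a at t = 0, where y'(0) = a D_{a-1}(0) = -
  D_{a+1}(0).\<close>

definition pcd_energy :: "real \<Rightarrow> real" where
  "pcd_energy a = (norm (pcd0 (of_real a + 1)))\<^sup>2 + (a + 1 / 2) * (norm (pcd0 (of_real a)))\<^sup>2"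

lemma pcd_energy_nonneg: "0 \<le> a \<Longrightarrow> 0 \<le> pcd_energy a"
  by (simp add: pcd_energy_def)

text \<open>
  $y = D_a$ solves $y'' = (t^2/4 - a - 1/2) y$, so the derivative of
  $|y'|^2 + (a + 1/2) |y|^2$ contains only the bounded coefficient $t^2/4$.
\<close>

lemma norm_parabolic_cylinder_D_le_energy:
  fixes a t Z :: real
  assumes a: "1 / 2 \<le> a" and t: "\<bar>t\<bar> \<le> Z"
  shows "(a + 1 / 2) * (norm (parabolic_cylinder_D (of_real a) (of_real t)))\<^sup>2
           \<le> pcd_energy a * exp (Z\<^sup>2 / 4 * Z)"
proof -
  define y where "y = (\<lambda>s::real. parabolic_cylinder_D (of_real a) (of_real s))"
  define w where "w = (\<lambda>s::real. of_real a * parabolic_cylinder_D (of_real a - 1) (of_real s) - of_real s / 2 * y s)"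
  have y': "(y has_vector_derivative w s) (at s)" for s
    unfolding y_def w_def by (rule has_vector_derivative_parabolic_cylinder_D)
  have w': "(w has_vector_derivative ((s\<^sup>2 / 4 - a - 1 / 2) *\<^sub>R y s)) (at s)" for s
  proof -
    have "(w has_vector_derivative
        (of_real a * ((of_real a - 1) * parabolic_cylinder_D (of_real a - 1 - 1) (of_real s)
          - of_real s / 2 * parabolic_cylinder_D (of_real a - 1) (of_real s))
         - (of_real s / 2 * w s + 1 / 2 * y s))) (at s)"
      unfolding w_def
      by (rule derivative_eq_intros has_vector_derivative_parabolic_cylinder_D y'[unfolded w_def] refl
          | (rule has_vector_derivative_real_field, (rule derivative_eq_intros refl)+))+ simp
    also have "of_real a * ((of_real a - 1) * parabolic_cylinder_D (of_real a - 1 - 1) (of_real s)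
          - of_real s / 2 * parabolic_cylinder_D (of_real a - 1) (of_real s))
         - (of_real s / 2 * w s + 1 / 2 * y s) = (s\<^sup>2 / 4 - a - 1 / 2) *\<^sub>R y s"
    proof -
      \<comment> \<open>The recurrence removes D_{a-2}; the remaining terms combine to the Weber
        equation.\<close>
      have "(of_real a - 1) * parabolic_cylinder_D (of_real a - 1 - 1) (of_real s) =
          of_real s * parabolic_cylinder_D (of_real a - 1) (of_real s) - y s"
        using parabolic_cylinder_D_plus1[of "of_real a - 1" "of_real s"] by (simp add: y_def)
      then show ?thesis
        by (simp only:) (simp add: w_def scaleR_conv_of_real power2_eq_square algebra_simps)
    qed
    finally show ?thesis .
  qed
  define N where "N = (\<lambda>s. (norm (w s))\<^sup>2 + (a + 1 / 2) * (norm (y s))\<^sup>2)"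
  define N' where "N' = (\<lambda>s. s\<^sup>2 / 2 * (w s \<bullet> y s))"
  have der: "(N has_real_derivative N' s) (at s)" for s
    unfolding N_def N'_def
    by (rule derivative_eq_intros has_real_derivative_norm_square w' y' refl)+
       (simp add: inner_commute algebra_simps)
  have bound: "\<bar>N' s\<bar> \<le> Z\<^sup>2 / 4 * N s" if "\<bar>s\<bar> \<le> Z" for s
  proof -
    have "\<bar>w s \<bullet> y s\<bar> \<le> norm (w s) * norm (y s)" by (rule Cauchy_Schwarz_ineq2)
    also have "\<dots> \<le> ((norm (w s))\<^sup>2 + (norm (y s))\<^sup>2) / 2"
      using sum_squares_bound[of "norm (w s)" "norm (y s)"] by simp
    \<comment> \<open>The hypothesis 1/2 \<le> a enters here: it makes the weight a + 1/2 at least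
      1.\<close>
    also have "(norm (y s))\<^sup>2 \<le> (a + 1 / 2) * (norm (y s))\<^sup>2"
      using a mult_right_mono[of 1 "a + 1 / 2" "(norm (y s))\<^sup>2"] by simp
    finally have 1: "\<bar>w s \<bullet> y s\<bar> \<le> N s / 2" by (simp add: N_def)
    have "s\<^sup>2 \<le> Z\<^sup>2" using that by (simp add: abs_le_square_iff[symmetric])
    then have "s\<^sup>2 / 2 * \<bar>w s \<bullet> y s\<bar> \<le> Z\<^sup>2 / 2 * (N s / 2)"
      using 1 by (intro mult_mono) auto
    then show ?thesis by (simp add: N'_def abs_mult)
  qed
  have "N t \<le> N 0 * exp (Z\<^sup>2 / 4 * \<bar>t\<bar>)"
    by (rule gronwall_abs[OF der bound t])
  also have "N 0 = pcd_energy a"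
    using pcd0_plus1[of "of_real a"] by (simp add: N_def w_def y_def pcd_energy_def)
  also have "pcd_energy a * exp (Z\<^sup>2 / 4 * \<bar>t\<bar>) \<le> pcd_energy a * exp (Z\<^sup>2 / 4 * Z)"
    using pcd_energy_nonneg[of a] a t by (intro mult_left_mono) (auto intro: mult_left_mono)
  finally show ?thesis by (simp add: N_def y_def add_nonneg_nonneg order_trans[rotated])
qed

text \<open>Raising a exchanges the roles of the two summands, because |D_{a+2}(0)| = (a+1)
  |D_a(0)|. One summand is multiplied by exactly (a+1)^2/(a+1/2), the other by a + 3/2, which is
  smaller since (a+3/2)(a+1/2) = (a+1)^2 - 1/4.\<close>

lemma pcd_energy_plus1:
  assumes "0 \<le> a"
  shows "pcd_energy (a + 1) \<le> (a + 1)\<^sup>2 / (a + 1 / 2) * pcd_energy a"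
proof -
  have "norm (pcd0 (of_real (a + 1) + 1)) = (a + 1) * norm (pcd0 (of_real a))"
  proof -
    have "pcd0 (of_real (a + 1) + 1) = - (of_real (a + 1) * pcd0 (of_real a))"
      using pcd0_plus1[of "of_real (a + 1)"] by (simp add: algebra_simps)
    then show ?thesis using assms by (simp only: norm_minus_cancel norm_mult norm_of_real)
  qed
  then have "pcd_energy (a + 1) = (a + 1)\<^sup>2 * (norm (pcd0 (of_real a)))\<^sup>2
      + (a + 3 / 2) * (norm (pcd0 (of_real a + 1)))\<^sup>2"
    by (simp add: pcd_energy_def power_mult_distrib)
  also have "a + 3 / 2 \<le> (a + 1)\<^sup>2 / (a + 1 / 2)"
    using assms by (simp add: field_simps power2_eq_square)
  also have "(a + 1)\<^sup>2 * (norm (pcd0 (of_real a)))\<^sup>2 =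
      (a + 1)\<^sup>2 / (a + 1 / 2) * ((a + 1 / 2) * (norm (pcd0 (of_real a)))\<^sup>2)"
    using assms by simp
  finally show ?thesis
    by (simp add: pcd_energy_def distrib_left mult_right_mono add.commute)
qed

definition pcd_term :: "real \<Rightarrow> nat \<Rightarrow> real \<Rightarrow> complex" where
  "pcd_term \<mu> n t = parabolic_cylinder_D (of_nat n) (of_real t) *
     parabolic_cylinder_D (of_real \<mu> + of_nat n - 1) (of_real t) / fact n"

text \<open>The quotients on the right telescope to a multiple of (n+1)^e.\<close>

lemma powr_growth_of_ratio:
  fixes Q :: "nat \<Rightarrow> real"
  assumes ratio: "eventually (\<lambda>n. Q (Suc n) \<le> (real (n + 2) / real (n + 1)) powr e * Q n) sequentially"
  shows "\<exists>C. eventually (\<lambda>n. Q n \<le> C * real (Suc n) powr e) sequentially"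
proof -
  from ratio obtain N where N: "\<And>n. n \<ge> N \<Longrightarrow> Q (Suc n) \<le> (real (n + 2) / real (n + 1)) powr e * Q n"
    by (auto simp: eventually_sequentially)
  define C where "C = Q N / real (Suc N) powr e"
  have "Q n \<le> C * real (Suc n) powr e" if "N \<le> n" for n
    using that
  proof (induction n rule: dec_induct)
    case base
    show ?case by (simp add: C_def)
  next
    case (step n)
    have "Q (Suc n) \<le> (real (n + 2) / real (n + 1)) powr e * Q n" by (rule N) fact
    also have "\<dots> \<le> (real (n + 2) / real (n + 1)) powr e * (C * real (Suc n) powr e)"
      by (intro mult_left_mono step.IH) simp
    also have "\<dots> = C * real (Suc (Suc n)) powr e"
      by (simp add: powr_divide)
    finally show ?case .
  qed
  then show ?thesis by (auto simp: eventually_sequentially)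
qed

text \<open>With r(a) = (a+1)^2/(a+1/2) = a + 3/2 + O(1/a), the quotient of consecutive terms is at
  most r(n) r(\<mu>+n-1)/(n+1)^2 = 1 + \<mu>/n + O(1/n^2). The comparison quotient is 1 + e/n +
  O(1/n^2), so any e > \<mu> suffices.\<close>

lemma pcd_energy_product_growth:
  assumes "\<mu> < e"
  shows "\<exists>C. eventually (\<lambda>n. pcd_energy (real n) * pcd_energy (\<mu> + real n - 1) / (fact n)\<^sup>2
            \<le> C * real (Suc n) powr e) sequentially"
proof (rule powr_growth_of_ratio)
  define r where "r = (\<lambda>a::real. (a + 1)\<^sup>2 / (a + 1 / 2))"
  have "eventually (\<lambda>n::nat. r (real n) * r (\<mu> + real n - 1) / (real (n + 1))\<^sup>2
      \<le> (real (n + 2) / real (n + 1)) powr e) sequentially"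
    using assms unfolding r_def by real_asymp
  moreover have "eventually (\<lambda>n::nat. 0 \<le> \<mu> + real n - 1) sequentially"
    by real_asymp
  ultimately show "eventually (\<lambda>n. pcd_energy (real (Suc n)) * pcd_energy (\<mu> + real (Suc n) - 1) / (fact (Suc n))\<^sup>2
      \<le> (real (n + 2) / real (n + 1)) powr e * (pcd_energy (real n) * pcd_energy (\<mu> + real n - 1) / (fact n)\<^sup>2)) sequentially"
  proof eventually_elim
    case (elim n)
    define b where "b = \<mu> + real n - 1"
    have b: "0 \<le> b" using elim by (simp add: b_def)
    have 1: "pcd_energy (real (Suc n)) \<le> r (real n) * pcd_energy (real n)"
      using pcd_energy_plus1[of "real n"] by (simp add: r_def add.commute)
    have 2: "pcd_energy (b + 1) \<le> r b * pcd_energy b"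
      using pcd_energy_plus1[OF b] by (simp add: r_def)
    have nn: "0 \<le> pcd_energy (real n)" "0 \<le> pcd_energy b" "0 \<le> pcd_energy (b + 1)" "0 \<le> r (real n)"
      using b by (auto intro!: pcd_energy_nonneg simp: r_def)
    have "pcd_energy (real (Suc n)) * pcd_energy (b + 1) \<le> (r (real n) * pcd_energy (real n)) * (r b * pcd_energy b)"
      using nn by (intro mult_mono 1 2) auto
    then have "pcd_energy (real (Suc n)) * pcd_energy (b + 1) / (fact (Suc n))\<^sup>2
        \<le> (r (real n) * pcd_energy (real n)) * (r b * pcd_energy b) / (fact (Suc n))\<^sup>2"
      by (intro divide_right_mono) auto
    also have "\<dots> = r (real n) * r b / (real (n + 1))\<^sup>2 * (pcd_energy (real n) * pcd_energy b / (fact n)\<^sup>2)"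
      by (simp add: fact_Suc power_mult_distrib mult_ac add.commute)
    also have "\<dots> \<le> (real (n + 2) / real (n + 1)) powr e * (pcd_energy (real n) * pcd_energy b / (fact n)\<^sup>2)"
      using elim(1) nn unfolding b_def[symmetric] by (intro mult_right_mono) auto
    finally show ?case by (simp add: b_def add_ac)
  qed
qed

lemma norm_pcd_term_eventually_le:
  assumes "\<mu> / 2 - 1 < p"
  shows "\<exists>C. eventually (\<lambda>n. \<forall>t. \<bar>t\<bar> \<le> Z \<longrightarrow> norm (pcd_term \<mu> n t) \<le> C * real (Suc n) powr p) sequentially"
proof -
  \<comment> \<open>The midpoint between \<mu> and 2p + 2. The lower bound feeds the growth of the
    energies; the upper one gives n^(e-2) = O(n^(2p)) once the two weights, each of order n, are
    divided out.\<close>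
  define e where "e = (\<mu> / 2 + p + 1)"
  have e: "\<mu> < e" "e < 2 * p + 2" using assms by (simp_all add: e_def)
  from pcd_energy_product_growth[OF e(1)] obtain C where
    C: "eventually (\<lambda>n. pcd_energy (real n) * pcd_energy (\<mu> + real n - 1) / (fact n)\<^sup>2
            \<le> C * real (Suc n) powr e) sequentially" by blast
  define G where "G = exp (Z\<^sup>2 / 4 * Z)"
  have "eventually (\<lambda>n::nat. real (Suc n) powr e / ((real n + 1 / 2) * (\<mu> + real n - 1 / 2)) \<le> real (Suc n) powr (2 * p)) sequentially"
    using e(2) by real_asymp
  moreover have "eventually (\<lambda>n::nat. 1 / 2 \<le> \<mu> + real n - 1) sequentially" by real_asymp
  moreover have "eventually (\<lambda>n::nat. n \<ge> 1) sequentially" by (rule eventually_ge_at_top)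
  ultimately have "eventually (\<lambda>n. \<forall>t. \<bar>t\<bar> \<le> Z \<longrightarrow>
      norm (pcd_term \<mu> n t) \<le> sqrt (\<bar>C\<bar> * G\<^sup>2) * real (Suc n) powr p) sequentially"
    using C
  proof eventually_elim
    case (elim n)
    define b where "b = \<mu> + real n - 1"
    show ?case
    proof (intro allI impI)
      fix t :: real assume t: "\<bar>t\<bar> \<le> Z"
      let ?x = "norm (parabolic_cylinder_D (of_nat n) (of_real t))"
      let ?y = "norm (parabolic_cylinder_D (of_real b) (of_real t))"
      have n: "1 / 2 \<le> real n" and b: "1 / 2 \<le> b" using elim by (simp_all add: b_def)
      have 1: "(real n + 1 / 2) * ?x\<^sup>2 \<le> pcd_energy (real n) * G"
        using norm_parabolic_cylinder_D_le_energy[OF n t] by (simp add: G_def)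
      have 2: "(b + 1 / 2) * ?y\<^sup>2 \<le> pcd_energy b * G"
        using norm_parabolic_cylinder_D_le_energy[OF b t] by (simp add: G_def)
      have pos: "0 < (real n + 1 / 2) * (b + 1 / 2)" using n b by simp
      have "((real n + 1 / 2) * ?x\<^sup>2) * ((b + 1 / 2) * ?y\<^sup>2) \<le> (pcd_energy (real n) * G) * (pcd_energy b * G)"
        using n b by (intro mult_mono 1 2) (auto intro!: mult_nonneg_nonneg pcd_energy_nonneg simp: G_def)
      then have "(?x * ?y / fact n)\<^sup>2 \<le> (pcd_energy (real n) * pcd_energy b / (fact n)\<^sup>2) * G\<^sup>2 / ((real n + 1 / 2) * (b + 1 / 2))"
        using pos by (simp add: pos_le_divide_eq power_mult_distrib power_divide divide_right_mono mult_ac power2_eq_square)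
      also have "\<dots> \<le> (\<bar>C\<bar> * real (Suc n) powr e) * G\<^sup>2 / ((real n + 1 / 2) * (b + 1 / 2))"
      proof (intro divide_right_mono mult_right_mono)
        have "pcd_energy (real n) * pcd_energy b / (fact n)\<^sup>2 \<le> C * real (Suc n) powr e"
          using elim(4) by (simp add: b_def)
        also have "\<dots> \<le> \<bar>C\<bar> * real (Suc n) powr e" by (intro mult_right_mono) auto
        finally show "pcd_energy (real n) * pcd_energy b / (fact n)\<^sup>2 \<le> \<bar>C\<bar> * real (Suc n) powr e" .
      qed (use pos in auto)
      also have "\<dots> = (\<bar>C\<bar> * G\<^sup>2) * (real (Suc n) powr e / ((real n + 1 / 2) * (b + 1 / 2)))"
        by simp
      also have "\<dots> \<le> (\<bar>C\<bar> * G\<^sup>2) * real (Suc n) powr (2 * p)"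
        using elim(1) by (intro mult_left_mono) (auto simp: b_def algebra_simps)
      also have "real (Suc n) powr (2 * p) = (real (Suc n) powr p)\<^sup>2"
        by (simp add: powr_power mult.commute)
      finally have "?x * ?y / fact n \<le> sqrt ((\<bar>C\<bar> * G\<^sup>2) * (real (Suc n) powr p)\<^sup>2)"
        by (rule real_le_rsqrt)
      then show "norm (pcd_term \<mu> n t) \<le> sqrt (\<bar>C\<bar> * G\<^sup>2) * real (Suc n) powr p"
        by (simp add: pcd_term_def norm_mult norm_divide b_def real_sqrt_mult)
    qed
  qed
  then show ?thesis by blast
qed

section \<open>Bounds uniform in n and in compact ranges of t\<close>

lemma continuous_on_pcd_term: "continuous_on S (pcd_term \<mu> n)"
proof -
  have "continuous_on S (\<lambda>t. parabolic_cylinder_D a (complex_of_real t))" for a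
    unfolding continuous_on_eq_continuous_within
    using has_vector_derivative_continuous[OF has_vector_derivative_parabolic_cylinder_D] by blast
  then show ?thesis unfolding pcd_term_def[abs_def] by (intro continuous_intros) auto
qed

lemma norm_pcd_term_le:
  assumes "\<mu> / 2 - 1 < p"
  shows "\<exists>C. \<forall>n t. \<bar>t\<bar> \<le> Z \<longrightarrow> norm (pcd_term \<mu> n t) \<le> C * real (Suc n) powr p"
proof -
  from norm_pcd_term_eventually_le[OF assms, of Z] obtain C N where
    C: "\<And>n t. n \<ge> N \<Longrightarrow> \<bar>t\<bar> \<le> Z \<Longrightarrow> norm (pcd_term \<mu> n t) \<le> C * real (Suc n) powr p"
    by (auto simp: eventually_sequentially)
  have "\<exists>B. \<forall>t\<in>{-Z..Z}. norm (pcd_term \<mu> n t) \<le> B" for n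
    using compact_imp_bounded[OF compact_continuous_image[OF continuous_on_pcd_term[of "{-Z..Z}" \<mu> n]]]
    by (auto simp: bounded_iff)
  then obtain B where B: "\<And>n t. t \<in> {-Z..Z} \<Longrightarrow> norm (pcd_term \<mu> n t) \<le> B n" by metis
  \<comment> \<open>The finitely many exceptional n are bounded by continuity on a compact interval.
    Absolute values make every contribution nonnegative, so the sum dominates each of them.\<close>
  define C' where "C' = \<bar>C\<bar> + (\<Sum>n<N. \<bar>B n\<bar> / real (Suc n) powr p)"
  have "norm (pcd_term \<mu> n t) \<le> C' * real (Suc n) powr p" if t: "\<bar>t\<bar> \<le> Z" for n t
  proof (cases "n < N")
    case True
    have "norm (pcd_term \<mu> n t) \<le> \<bar>B n\<bar>" using B[of t n] t by (auto simp: abs_le_iff)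
    also have "\<dots> = \<bar>B n\<bar> / real (Suc n) powr p * real (Suc n) powr p" by simp
    also have "\<bar>B n\<bar> / real (Suc n) powr p \<le> (\<Sum>n<N. \<bar>B n\<bar> / real (Suc n) powr p)"
      using True by (intro member_le_sum) auto
    also have "\<dots> \<le> C'" by (simp add: C'_def)
    finally show ?thesis by (simp add: mult_right_mono)
  next
    case False
    then have "norm (pcd_term \<mu> n t) \<le> C * real (Suc n) powr p" using C t by simp
    also have "C \<le> \<bar>C\<bar>" by simp
    also have "\<bar>C\<bar> \<le> C'" by (auto simp: C'_def intro!: sum_nonneg)
    finally show ?thesis by (simp add: mult_right_mono)
  qed
  then show ?thesis by blast
qed

section \<open>The series and its contiguous relations\<close>

text \<open>The recurrence applied to the second factor alone; the index n of the first factor stays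
  fixed.\<close>

lemma pcd_term_plus1:
  "pcd_term (\<mu> + 1) n t = of_real t * pcd_term \<mu> n t - (of_real \<mu> + of_nat n - 1) * pcd_term (\<mu> - 1) n t"
proof -
  have "parabolic_cylinder_D (of_real (\<mu> + 1) + of_nat n - 1) (of_real t) =
      of_real t * parabolic_cylinder_D (of_real \<mu> + of_nat n - 1) (of_real t) -
      (of_real \<mu> + of_nat n - 1) * parabolic_cylinder_D (of_real (\<mu> - 1) + of_nat n - 1) (of_real t)"
    using parabolic_cylinder_D_plus1[of "of_real \<mu> + of_nat n - 1" "of_real t"] by (simp add: algebra_simps)
  then show ?thesis
    unfolding pcd_term_def by (simp only:) (simp add: field_simps)
qed

text \<open>The recurrence applied to the first factor. The second factor is D_{\<mu>+n} in all
  three terms, which is why \<mu> rises as n falls. The value 0 at n = 0 is forced by the factor n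
  in front of D_{n-1}.\<close>

lemma pcd_term_Suc:
  "of_nat (Suc n) * pcd_term \<mu> (Suc n) t =
     of_real t * pcd_term (\<mu> + 1) n t - (case n of 0 \<Rightarrow> 0 | Suc k \<Rightarrow> pcd_term (\<mu> + 2) k t)"
proof -
  have D: "parabolic_cylinder_D (of_nat (Suc n)) (of_real t) =
      of_real t * parabolic_cylinder_D (of_nat n) (of_real t) -
      of_nat n * parabolic_cylinder_D (of_nat n - 1) (of_real t)"
    using parabolic_cylinder_D_plus1[of "of_nat n" "of_real t"] by (simp add: add.commute)
  have f: "of_nat (Suc n) * (x / fact (Suc n)) = (x / fact n :: complex)" for x
    by (simp add: fact_Suc del: of_nat_Suc)
  have "of_nat (Suc n) * pcd_term \<mu> (Suc n) t = parabolic_cylinder_D (of_nat (Suc n)) (of_real t) *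
          parabolic_cylinder_D (of_real \<mu> + of_nat n) (of_real t) / fact n"
    unfolding pcd_term_def f by simp
  also have "\<dots> = of_real t * pcd_term (\<mu> + 1) n t - of_nat n * parabolic_cylinder_D (of_nat n - 1) (of_real t) *
          parabolic_cylinder_D (of_real \<mu> + of_nat n) (of_real t) / fact n"
    unfolding D pcd_term_def by (simp add: algebra_simps diff_divide_distrib)
  also have "of_nat n * parabolic_cylinder_D (of_nat n - 1) (of_real t) *
          parabolic_cylinder_D (of_real \<mu> + of_nat n) (of_real t) / fact n =
          (case n of 0 \<Rightarrow> 0 | Suc k \<Rightarrow> pcd_term (\<mu> + 2) k t)"
  proof (cases n)
    case (Suc k)
    have "of_nat (Suc k) * x * y / fact (Suc k) = (x * y / fact k :: complex)" for x y
      by (simp add: fact_Suc del: of_nat_Suc)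
    then show ?thesis unfolding Suc pcd_term_def
      by (simp only: nat.case) (simp add: algebra_simps)
  qed simp
  finally show ?thesis .
qed

text \<open>The two terms -t/2 from the derivatives of the factors add up to -t, which cancels the t
  of the recurrence for the second factor.\<close>

lemma has_vector_derivative_pcd_term:
  "(pcd_term \<mu> n has_vector_derivative
     (case n of 0 \<Rightarrow> 0 | Suc k \<Rightarrow> pcd_term (\<mu> + 1) k t) - pcd_term (\<mu> + 1) n t) (at t)"
proof -
  define b where "b = complex_of_real \<mu> + of_nat n - 1"
  let ?D = "\<lambda>a. parabolic_cylinder_D a (complex_of_real t)"
  have rec: "b * ?D (b - 1) = of_real t * ?D b - ?D (b + 1)"
    using parabolic_cylinder_D_plus1[of b "of_real t"] by simp
  have "((\<lambda>t. parabolic_cylinder_D (of_nat n) (complex_of_real t) * parabolic_cylinder_D b (complex_of_real t) / fact n)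
     has_vector_derivative (?D (of_nat n) * (b * ?D (b - 1) - of_real t / 2 * ?D b) +
       (of_nat n * ?D (of_nat n - 1) - of_real t / 2 * ?D (of_nat n)) * ?D b) / fact n) (at t)"
    by (intro has_vector_derivative_divide has_vector_derivative_mult has_vector_derivative_parabolic_cylinder_D)
  also have "(?D (of_nat n) * (b * ?D (b - 1) - of_real t / 2 * ?D b) +
       (of_nat n * ?D (of_nat n - 1) - of_real t / 2 * ?D (of_nat n)) * ?D b) / fact n =
       of_nat n * ?D (of_nat n - 1) * ?D b / fact n - ?D (of_nat n) * ?D (b + 1) / fact n"
    unfolding rec by (simp add: field_simps)
  also have "?D (of_nat n) * ?D (b + 1) / fact n = pcd_term (\<mu> + 1) n t"
    by (simp add: pcd_term_def b_def add_ac)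
  also have "of_nat n * ?D (of_nat n - 1) * ?D b / fact n = (case n of 0 \<Rightarrow> 0 | Suc k \<Rightarrow> pcd_term (\<mu> + 1) k t)"
  proof (cases n)
    case (Suc k)
    have "of_nat (Suc k) * x * y / fact (Suc k) = (x * y / fact k :: complex)" for x y
      by (simp add: fact_Suc del: of_nat_Suc)
    then show ?thesis unfolding Suc pcd_term_def b_def
      by (simp only: nat.case) (simp add: algebra_simps)
  qed simp
  finally show ?thesis unfolding pcd_term_def[abs_def] b_def .
qed

lemma pcd_term_tendsto_0:
  assumes "\<mu> < 2"
  shows "(\<lambda>n. pcd_term \<mu> n t) \<longlonglongrightarrow> 0"
proof -
  \<comment> \<open>The exponent halfway between the critical \<mu>/2 - 1 and 0.\<close>
  have "\<mu> / 2 - 1 < \<mu> / 4 - 1 / 2" using assms by simp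
  from norm_pcd_term_le[OF this, of "\<bar>t\<bar>"] obtain C where
    C: "\<And>n. norm (pcd_term \<mu> n t) \<le> C * real (Suc n) powr (\<mu> / 4 - 1 / 2)" by auto
  have "\<mu> / 4 - 1 / 2 < 0" using assms by simp
  then have lim: "(\<lambda>n. C * real (Suc n) powr (\<mu> / 4 - 1 / 2)) \<longlonglongrightarrow> 0" by real_asymp
  show ?thesis by (rule Lim_null_comparison[OF always_eventually[OF allI[OF C]] lim])
qed

lemma summable_Suc_powr: "p < -1 \<Longrightarrow> summable (\<lambda>n. real (Suc n) powr p)"
  using summable_Suc_iff[of "\<lambda>n. real n powr p"] summable_real_powr_iff[of p] by simp

lemma summable_norm_pcd_term:
  assumes "\<mu> < 0"
  shows "summable (\<lambda>n. norm (pcd_term \<mu> n t))"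
proof -
  \<comment> \<open>The exponent halfway between the critical \<mu>/2 - 1 and -1, the limit of
    summability.\<close>
  have "\<mu> / 2 - 1 < \<mu> / 4 - 1" using assms by simp
  from norm_pcd_term_le[OF this, of "\<bar>t\<bar>"] obtain C where
    C: "\<And>n. norm (pcd_term \<mu> n t) \<le> C * real (Suc n) powr (\<mu> / 4 - 1)" by auto
  have "summable (\<lambda>n. C * real (Suc n) powr (\<mu> / 4 - 1))"
    using assms by (intro summable_mult summable_Suc_powr) simp
  then show ?thesis by (rule summable_comparison_test') (use C in auto)
qed

lemma pcd_term_sums_0:
  assumes "\<mu> < 0"
  shows "(\<lambda>n. pcd_term \<mu> n t) sums 0"
proof -
  \<comment> \<open>Eliminating t P_n(\<mu>+1) between the two recurrences leaves W_{n+1} - W_n =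
    \<mu> P_n(\<mu>). Both parts of W tend to 0 for \<mu> < 0: the factor n costs one power, and
    raising \<mu> by 2 costs the same.\<close>
  define W where "W = (\<lambda>n. of_nat n * pcd_term \<mu> n t - (case n of 0 \<Rightarrow> 0 | Suc k \<Rightarrow> pcd_term (\<mu> + 2) k t))"
  have tele: "W (Suc n) - W n = of_real \<mu> * pcd_term \<mu> n t" for n
  proof -
    have "pcd_term (\<mu> + 2) n t = of_real t * pcd_term (\<mu> + 1) n t - (of_real \<mu> + of_nat n) * pcd_term \<mu> n t"
      using pcd_term_plus1[of "\<mu> + 1" n t] by (simp add: add_ac)
    moreover have "W (Suc n) = of_nat (Suc n) * pcd_term \<mu> (Suc n) t - pcd_term (\<mu> + 2) n t"
      by (simp add: W_def)
    ultimately show ?thesis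
      unfolding pcd_term_Suc by (simp add: W_def algebra_simps)
  qed
  have 1: "(\<lambda>n. of_nat n * pcd_term \<mu> n t) \<longlonglongrightarrow> 0"
  proof -
    have "\<mu> / 2 - 1 < \<mu> / 4 - 1" using assms by simp
    from norm_pcd_term_le[OF this, of "\<bar>t\<bar>"] obtain C where
      C: "\<And>n. norm (pcd_term \<mu> n t) \<le> C * real (Suc n) powr (\<mu> / 4 - 1)" by auto
    have lim: "(\<lambda>n. real n * (C * real (Suc n) powr (\<mu> / 4 - 1))) \<longlonglongrightarrow> 0"
      using assms by real_asymp
    have bound: "norm (of_nat n * pcd_term \<mu> n t) \<le> real n * (C * real (Suc n) powr (\<mu> / 4 - 1))" for n
      unfolding norm_mult by (intro mult_mono C) auto
    show ?thesis by (rule Lim_null_comparison[OF always_eventually[OF allI[OF bound]] lim])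
  qed
  have 2: "(\<lambda>n. case n of 0 \<Rightarrow> 0 | Suc k \<Rightarrow> pcd_term (\<mu> + 2) k t) \<longlonglongrightarrow> 0"
    by (rule LIMSEQ_imp_Suc) (use assms in \<open>simp add: pcd_term_tendsto_0\<close>)
  have "W \<longlonglongrightarrow> 0 - 0" unfolding W_def by (intro tendsto_diff 1 2)
  then have "(\<lambda>n. W (Suc n) - W n) sums (0 - 0 - W 0)" by (rule telescope_sums)
  then have "(\<lambda>n. of_real \<mu> * pcd_term \<mu> n t) sums (of_real \<mu> * 0)"
    unfolding tele by (simp add: W_def)
  then show ?thesis using assms by (subst (asm) sums_mult_iff) auto
qed

section \<open>The series with denominators n + \<nu>\<close>

lemma of_nat_plus_nonzero: "(\<nu>::complex) \<notin> \<int>\<^sub>\<le>\<^sub>0 \<Longrightarrow> of_nat n + \<nu> \<noteq> 0"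
  by (metis add_eq_0_iff minus_of_nat_in_nonpos_Ints)

lemma plus1_notin_nonpos_Ints: "(\<nu>::complex) \<notin> \<int>\<^sub>\<le>\<^sub>0 \<Longrightarrow> \<nu> + 1 \<notin> \<int>\<^sub>\<le>\<^sub>0"
  using plus_one_in_nonpos_Ints_imp by blast

lemma norm_inverse_of_nat_plus_le:
  fixes \<nu> :: complex
  assumes "\<nu> \<notin> \<int>\<^sub>\<le>\<^sub>0"
  shows "\<exists>B>0. \<forall>n. norm (1 / (of_nat n + \<nu>)) \<le> B / real (Suc n)"
proof -
  from convergent_imp_Bseq[OF convergentI[OF tendsto_of_nat_plus_ratio[of 1 \<nu>]]]
  obtain B where B: "B > 0" "\<And>n. norm ((1 + of_nat n) / (\<nu> + of_nat n)) \<le> B"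
    by (auto simp: Bseq_def)
  have "norm (1 / (of_nat n + \<nu>)) \<le> B / real (Suc n)" for n
  proof -
    have "norm (of_nat (Suc n) * (1 / (of_nat n + \<nu>))) \<le> B" using B(2)[of n] by (simp add: add.commute)
    then have "real (Suc n) * norm (1 / (of_nat n + \<nu>)) \<le> B" by (simp only: norm_mult norm_of_nat)
    then show ?thesis by (simp add: field_simps del: of_nat_Suc)
  qed
  with B(1) show ?thesis by blast
qed

text \<open>The majorant does not depend on t in a bounded range, as termwise differentiation
  requires. The denominator gains one power of n, which extends summability from \<mu> < 0 to \<mu>
  < 2.\<close>

lemma pcd_series_majorant:
  assumes "\<mu> < 2" "\<nu> \<notin> \<int>\<^sub>\<le>\<^sub>0"
  shows "\<exists>M. summable M \<and> (\<forall>n t. \<bar>t\<bar> \<le> Z \<longrightarrow> norm (pcd_term \<mu> n t / (of_nat n + \<nu>)) \<le> M n)"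
proof -
  have "\<mu> / 2 - 1 < \<mu> / 4 - 1 / 2" using assms by simp
  from norm_pcd_term_le[OF this, of Z] obtain C where
    C: "\<And>n t. \<bar>t\<bar> \<le> Z \<Longrightarrow> norm (pcd_term \<mu> n t) \<le> C * real (Suc n) powr (\<mu> / 4 - 1 / 2)" by auto
  from norm_inverse_of_nat_plus_le[OF assms(2)] obtain B where
    B: "B > 0" "\<And>n. norm (1 / (of_nat n + \<nu>)) \<le> B / real (Suc n)" by blast
  define p where "p = \<mu> / 4 - 1 / 2"
  note C = C[folded p_def]
  define M where "M = (\<lambda>n. \<bar>C\<bar> * B * real (Suc n) powr (p - 1))"
  have "summable M" unfolding M_def using assms by (intro summable_mult summable_Suc_powr) (simp add: p_def)
  moreover have "norm (pcd_term \<mu> n t / (of_nat n + \<nu>)) \<le> M n" if t: "\<bar>t\<bar> \<le> Z" for n t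
  proof -
    have "norm (pcd_term \<mu> n t / (of_nat n + \<nu>)) = norm (pcd_term \<mu> n t) * norm (1 / (of_nat n + \<nu>))"
      by (simp add: norm_divide)
    also have "\<dots> \<le> (C * real (Suc n) powr p) * (B / real (Suc n))"
      using order_trans[OF norm_ge_zero C[OF t]] by (intro mult_mono C B t) auto
    also have "\<dots> \<le> (\<bar>C\<bar> * real (Suc n) powr p) * (B / real (Suc n))"
      using B(1) by (intro mult_right_mono) auto
    also have "\<dots> = M n" by (simp add: M_def powr_diff)
    finally show ?thesis .
  qed
  ultimately show ?thesis by blast
qed

definition pcd_series :: "complex \<Rightarrow> real \<Rightarrow> real \<Rightarrow> complex" where
  "pcd_series \<nu> \<mu> t = (\<Sum>n. pcd_term \<mu> n t / (of_nat n + \<nu>))"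

lemma pcd_series_sums:
  assumes "\<mu> < 2" "\<nu> \<notin> \<int>\<^sub>\<le>\<^sub>0"
  shows "(\<lambda>n. pcd_term \<mu> n t / (of_nat n + \<nu>)) sums pcd_series \<nu> \<mu> t"
proof -
  from pcd_series_majorant[OF assms, of "\<bar>t\<bar>"] obtain M where
    M: "summable M" "\<And>n. norm (pcd_term \<mu> n t / (of_nat n + \<nu>)) \<le> M n" by auto
  have "summable (\<lambda>n. pcd_term \<mu> n t / (of_nat n + \<nu>))"
    by (rule summable_comparison_test'[OF M(1)]) (rule M(2))
  then show ?thesis unfolding pcd_series_def by (rule summable_sums)
qed

text \<open>In \<open>pcd_term_plus1\<close> the factor \<mu> + n - 1 is written as (n + \<nu>) +
  (\<mu> - 1 - \<nu>). The first part cancels the denominator and contributes the sum of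
  P_n(\<mu>-1), which is 0 because \<mu> - 1 < 0.\<close>

lemma pcd_series_plus1:
  assumes "\<mu> < 1" "\<nu> \<notin> \<int>\<^sub>\<le>\<^sub>0"
  shows "pcd_series \<nu> (\<mu> + 1) t = of_real t * pcd_series \<nu> \<mu> t - (of_real \<mu> - 1 - \<nu>) * pcd_series \<nu> (\<mu> - 1) t"
proof -
  have "(\<lambda>n. of_real t * (pcd_term \<mu> n t / (of_nat n + \<nu>)) -
      (pcd_term (\<mu> - 1) n t + (of_real \<mu> - 1 - \<nu>) * (pcd_term (\<mu> - 1) n t / (of_nat n + \<nu>))))
      sums (of_real t * pcd_series \<nu> \<mu> t - (0 + (of_real \<mu> - 1 - \<nu>) * pcd_series \<nu> (\<mu> - 1) t))"
    using assms by (intro sums_diff sums_add sums_mult pcd_series_sums pcd_term_sums_0) auto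
  also have "(\<lambda>n. of_real t * (pcd_term \<mu> n t / (of_nat n + \<nu>)) -
      (pcd_term (\<mu> - 1) n t + (of_real \<mu> - 1 - \<nu>) * (pcd_term (\<mu> - 1) n t / (of_nat n + \<nu>)))) =
      (\<lambda>n. pcd_term (\<mu> + 1) n t / (of_nat n + \<nu>))"
  proof
    fix n
    have alg: "of_real t * (x / c) - (y + k * (y / c)) = (of_real t * x - (c + k) * y) / c" if "c \<noteq> 0" for x y c k :: complex
      using that by (simp add: field_simps)
    show "of_real t * (pcd_term \<mu> n t / (of_nat n + \<nu>)) -
      (pcd_term (\<mu> - 1) n t + (of_real \<mu> - 1 - \<nu>) * (pcd_term (\<mu> - 1) n t / (of_nat n + \<nu>))) =
      pcd_term (\<mu> + 1) n t / (of_nat n + \<nu>)"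
      unfolding alg[OF of_nat_plus_nonzero[OF assms(2)]] pcd_term_plus1 by (simp add: algebra_simps)
  qed
  finally show ?thesis
    using pcd_series_sums[of "\<mu> + 1" \<nu> t] assms by (simp add: sums_unique2)
qed

text \<open>Divide \<open>pcd_term_Suc\<close> by n + 1 + \<nu> and write (n+1)/(n+1+\<nu>) = 1 -
  \<nu>/(n+1+\<nu>). The constant part again sums to 0.\<close>

lemma pcd_series_shift:
  assumes "\<mu> < 0" "\<nu> \<notin> \<int>\<^sub>\<le>\<^sub>0"
  shows "pcd_series (\<nu> + 2) (\<mu> + 2) t = of_real t * pcd_series (\<nu> + 1) (\<mu> + 1) t + \<nu> * pcd_series \<nu> \<mu> t"
proof -
  have \<nu>1: "\<nu> + 1 \<notin> \<int>\<^sub>\<le>\<^sub>0" using assms(2) by (rule plus1_notin_nonpos_Ints)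
  have \<nu>2: "\<nu> + 2 \<notin> \<int>\<^sub>\<le>\<^sub>0" using plus1_notin_nonpos_Ints[OF \<nu>1] by (simp add: add.assoc)
  have prev: "(\<lambda>n. (case n of 0 \<Rightarrow> 0 | Suc k \<Rightarrow> pcd_term (\<mu> + 2) k t) / (of_nat n + (\<nu> + 1))) sums
      pcd_series (\<nu> + 2) (\<mu> + 2) t" (is "?g sums _")
  proof -
    have "(\<lambda>n. ?g (Suc n)) sums pcd_series (\<nu> + 2) (\<mu> + 2) t"
      using pcd_series_sums[of "\<mu> + 2" "\<nu> + 2" t] \<nu>2 assms(1) by (simp add: add_ac)
    then show ?thesis by (subst (asm) sums_Suc_iff) simp
  qed
  have "(\<lambda>n. of_real t * (pcd_term (\<mu> + 1) n t / (of_nat n + (\<nu> + 1))) - ?g n) sums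
     (of_real t * pcd_series (\<nu> + 1) (\<mu> + 1) t - pcd_series (\<nu> + 2) (\<mu> + 2) t)"
    using assms \<nu>1 by (intro sums_diff sums_mult prev pcd_series_sums) auto
  also have "(\<lambda>n. of_real t * (pcd_term (\<mu> + 1) n t / (of_nat n + (\<nu> + 1))) - ?g n) =
     (\<lambda>n. pcd_term \<mu> (Suc n) t - \<nu> * (pcd_term \<mu> (Suc n) t / (of_nat (Suc n) + \<nu>)))"
  proof
    fix n
    have ne: "of_nat (Suc n) + \<nu> \<noteq> 0" using of_nat_plus_nonzero[OF assms(2)] .
    have "of_real t * (pcd_term (\<mu> + 1) n t / (of_nat n + (\<nu> + 1))) - ?g n =
       of_nat (Suc n) * pcd_term \<mu> (Suc n) t / (of_nat (Suc n) + \<nu>)"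
      unfolding pcd_term_Suc by (simp add: diff_divide_distrib add_ac)
    also have "\<dots> = pcd_term \<mu> (Suc n) t - \<nu> * (pcd_term \<mu> (Suc n) t / (of_nat (Suc n) + \<nu>))"
      using ne by (simp add: field_simps del: of_nat_Suc)
    finally show "of_real t * (pcd_term (\<mu> + 1) n t / (of_nat n + (\<nu> + 1))) - ?g n =
      pcd_term \<mu> (Suc n) t - \<nu> * (pcd_term \<mu> (Suc n) t / (of_nat (Suc n) + \<nu>))" .
  qed
  \<comment> \<open>The sum so far starts at index 1. The term of index 0 is P_0 - \<nu> P_0/\<nu> =
    0, so including it changes nothing.\<close>
  finally have "(\<lambda>n. pcd_term \<mu> n t - \<nu> * (pcd_term \<mu> n t / (of_nat n + \<nu>))) sums
     (of_real t * pcd_series (\<nu> + 1) (\<mu> + 1) t - pcd_series (\<nu> + 2) (\<mu> + 2) t)"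
    using of_nat_plus_nonzero[OF assms(2), of 0] by (subst (asm) sums_Suc_iff) simp
  moreover have "(\<lambda>n. pcd_term \<mu> n t - \<nu> * (pcd_term \<mu> n t / (of_nat n + \<nu>))) sums (0 - \<nu> * pcd_series \<nu> \<mu> t)"
    using assms by (intro sums_diff sums_mult pcd_series_sums pcd_term_sums_0) auto
  ultimately have "of_real t * pcd_series (\<nu> + 1) (\<mu> + 1) t - pcd_series (\<nu> + 2) (\<mu> + 2) t = 0 - \<nu> * pcd_series \<nu> \<mu> t"
    by (rule sums_unique2)
  then show ?thesis by (simp add: algebra_simps)
qed

section \<open>Termwise differentiation in t\<close>

lemma has_vector_derivative_suminf:
  fixes f :: "nat \<Rightarrow> real \<Rightarrow> 'b::banach"
  assumes der: "\<And>n s. \<bar>s\<bar> < Z \<Longrightarrow> (f n has_vector_derivative f' n s) (at s)"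
    and bound: "\<And>n s. \<bar>s\<bar> < Z \<Longrightarrow> norm (f' n s) \<le> M n"
    and M: "summable M" and sm: "summable (\<lambda>n. f n t)" and t: "\<bar>t\<bar> < Z"
  shows "((\<lambda>s. \<Sum>n. f n s) has_vector_derivative (\<Sum>n. f' n t)) (at t)"
proof -
  let ?S = "{-Z<..<Z}"
  have S: "s \<in> ?S \<longleftrightarrow> \<bar>s\<bar> < Z" for s by (auto simp: abs_less_iff)
  have ul: "uniform_limit ?S (\<lambda>n s. \<Sum>i<n. f' i s) (\<lambda>s. \<Sum>i. f' i s) sequentially"
    by (rule Weierstrass_m_test[OF _ M]) (use bound S in blast)
  have "\<exists>g. \<forall>s\<in>?S. (\<lambda>n. f n s) sums g s \<and> (g has_derivative (\<lambda>h. h *\<^sub>R (\<Sum>i. f' i s))) (at s within ?S)"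
  proof (rule has_derivative_series)
    show "(f n has_derivative (\<lambda>h. h *\<^sub>R f' n s)) (at s within ?S)" if "s \<in> ?S" for n s
      using der[of s n] that S by (auto simp: has_vector_derivative_def intro: has_derivative_at_withinI)
    show "\<forall>\<^sub>F n in sequentially. \<forall>s\<in>?S. \<forall>h. norm ((\<Sum>i<n. h *\<^sub>R f' i s) - h *\<^sub>R (\<Sum>i. f' i s)) \<le> e * norm h"
      if "e > 0" for e
      using uniform_limitD[OF ul that]
    proof eventually_elim
      case (elim n)
      have "norm ((\<Sum>i<n. h *\<^sub>R f' i s) - h *\<^sub>R (\<Sum>i. f' i s)) \<le> e * norm h" if "s \<in> ?S" for s h
      proof -
        have "norm ((\<Sum>i<n. h *\<^sub>R f' i s) - h *\<^sub>R (\<Sum>i. f' i s)) =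
            norm h * dist (\<Sum>i<n. f' i s) (\<Sum>i. f' i s)"
          by (simp add: scaleR_sum_right[symmetric] scaleR_diff_right[symmetric] dist_norm)
        also have "\<dots> \<le> norm h * e" using elim that by (intro mult_left_mono) (auto intro: less_imp_le)
        finally show ?thesis by (simp add: mult.commute)
      qed
      then show ?case by blast
    qed
    show "t \<in> ?S" using t S by blast
    show "(\<lambda>n. f n t) sums (\<Sum>n. f n t)" using sm by (rule summable_sums)
  qed simp
  then obtain g where g: "\<And>s. s \<in> ?S \<Longrightarrow> (\<lambda>n. f n s) sums g s"
    "\<And>s. s \<in> ?S \<Longrightarrow> (g has_derivative (\<lambda>h. h *\<^sub>R (\<Sum>i. f' i s))) (at s within ?S)" by blast
  have tS: "t \<in> ?S" using t S by blast
  have "(g has_derivative (\<lambda>h. h *\<^sub>R (\<Sum>i. f' i t))) (at t)"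
    using g(2)[OF tS] at_within_open[OF tS open_greaterThanLessThan] by simp
  then have "((\<lambda>s. \<Sum>n. f n s) has_derivative (\<lambda>h. h *\<^sub>R (\<Sum>i. f' i t))) (at t)"
    by (rule has_derivative_transform_within_open[OF _ open_greaterThanLessThan tS])
       (use g(1) in \<open>auto simp: sums_iff\<close>)
  then show ?thesis by (simp add: has_vector_derivative_def)
qed

lemma has_vector_derivative_pcd_series:
  assumes "\<mu> < 1" "\<nu> \<notin> \<int>\<^sub>\<le>\<^sub>0"
  shows "(pcd_series \<nu> \<mu> has_vector_derivative
           (pcd_series (\<nu> + 1) (\<mu> + 1) t - pcd_series \<nu> (\<mu> + 1) t)) (at t)"
proof -
  have \<nu>1: "\<nu> + 1 \<notin> \<int>\<^sub>\<le>\<^sub>0" using assms(2) by (rule plus1_notin_nonpos_Ints)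
  define Z where "Z = \<bar>t\<bar> + 1"
  have \<mu>: "\<mu> + 1 < 2" using assms by simp
  from pcd_series_majorant[OF \<mu> assms(2), of Z] obtain M0 where
    M0: "summable M0" "\<And>n t. \<bar>t\<bar> \<le> Z \<Longrightarrow> norm (pcd_term (\<mu> + 1) n t / (of_nat n + \<nu>)) \<le> M0 n" by blast
  from pcd_series_majorant[OF \<mu> \<nu>1, of Z] obtain M1 where
    M1: "summable M1" "\<And>n t. \<bar>t\<bar> \<le> Z \<Longrightarrow> norm (pcd_term (\<mu> + 1) n t / (of_nat n + (\<nu> + 1))) \<le> M1 n" by blast
  define g where "g = (\<lambda>n s. (case n of 0 \<Rightarrow> 0 | Suc k \<Rightarrow> pcd_term (\<mu> + 1) k s) / (of_nat n + \<nu>))"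
  \<comment> \<open>The terms P_{n-1}(\<mu>+1)/(n+\<nu>) are those of the series for \<nu> + 1 moved
    by one place, so its majorant is moved as well.\<close>
  define M1' where "M1' = (\<lambda>n. case n of 0 \<Rightarrow> 0 | Suc k \<Rightarrow> M1 k)"
  have g_Suc: "g (Suc k) s = pcd_term (\<mu> + 1) k s / (of_nat k + (\<nu> + 1))" for k s
    by (simp add: g_def add_ac)
  have sm: "summable (\<lambda>n. M1' n + M0 n)"
  proof (rule summable_add[OF _ M0(1)])
    show "summable M1'" using M1(1) by (subst summable_Suc_iff[symmetric]) (simp add: M1'_def)
  qed
  have g_bound: "norm (g n s) \<le> M1' n" if "\<bar>s\<bar> < Z" for n s
  proof (cases n)
    case 0
    then show ?thesis by (simp add: g_def M1'_def)
  next
    case (Suc k)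
    then show ?thesis using M1(2)[of s k] that by (simp add: g_Suc M1'_def)
  qed
  have g_sums: "(\<lambda>n. g n t) sums pcd_series (\<nu> + 1) (\<mu> + 1) t"
  proof -
    have "(\<lambda>n. g (Suc n) t) sums pcd_series (\<nu> + 1) (\<mu> + 1) t"
      unfolding g_Suc using \<mu> \<nu>1 by (rule pcd_series_sums)
    then show ?thesis by (subst (asm) sums_Suc_iff) (simp add: g_def)
  qed
  have "((\<lambda>s. \<Sum>n. pcd_term \<mu> n s / (of_nat n + \<nu>)) has_vector_derivative
      (\<Sum>n. g n t - pcd_term (\<mu> + 1) n t / (of_nat n + \<nu>))) (at t)"
  proof (rule has_vector_derivative_suminf[OF _ _ sm])
    show "((\<lambda>s. pcd_term \<mu> n s / (of_nat n + \<nu>)) has_vector_derivative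
       g n s - pcd_term (\<mu> + 1) n s / (of_nat n + \<nu>)) (at s)" for n s
      unfolding g_def diff_divide_distrib[symmetric]
      by (intro has_vector_derivative_divide has_vector_derivative_pcd_term)
    show "norm (g n s - pcd_term (\<mu> + 1) n s / (of_nat n + \<nu>)) \<le> M1' n + M0 n" if "\<bar>s\<bar> < Z" for n s
      using norm_triangle_ineq4[of "g n s" "pcd_term (\<mu> + 1) n s / (of_nat n + \<nu>)"]
        g_bound[OF that, of n] M0(2)[of s n] that by simp
    show "summable (\<lambda>n. pcd_term \<mu> n t / (of_nat n + \<nu>))"
      using pcd_series_sums[of \<mu> \<nu> t] assms by (simp add: sums_summable)
  qed (simp add: Z_def)
  also have "(\<Sum>n. g n t - pcd_term (\<mu> + 1) n t / (of_nat n + \<nu>)) =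
      pcd_series (\<nu> + 1) (\<mu> + 1) t - pcd_series \<nu> (\<mu> + 1) t"
    by (intro sums_unique[symmetric] sums_diff g_sums pcd_series_sums \<mu> assms)
  finally show ?thesis unfolding pcd_series_def[abs_def] .
qed

section \<open>Gauss summation\<close>

text \<open>As a function of x the right side has simple poles at 0, -1, ..., -N, and the numerators
  on the left are its residues. The induction generalizes x because the hypothesis is used twice, at
  x and at the new pole.\<close>

lemma pochhammer_quotient_partial_fractions:
  fixes x y :: "'a::field_char_0"
  assumes "\<And>k. k \<le> N \<Longrightarrow> x + of_nat k \<noteq> 0"
  shows "(\<Sum>k\<le>N. (-1) ^ k * pochhammer (y - of_nat k) N / (fact k * fact (N - k)) / (x + of_nat k)) =
           pochhammer (x + y) N / pochhammer x (Suc N)"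
  using assms
proof (induction N arbitrary: x)
  case 0
  then show ?case by simp
next
  case (Suc N)
  define r where "r = (\<lambda>N k. (-1) ^ k * pochhammer (y - of_nat k) N / (fact k * fact (N - k)))"
  define w where "w = x + of_nat (Suc N)"
  have w: "w \<noteq> 0" using Suc.prems[of "Suc N"] by (simp add: w_def)
  have ne: "x + of_nat k \<noteq> 0" if "k \<le> N" for k using Suc.prems[of k] that by simp
  have IH: "(\<Sum>k\<le>N. r N k / (x + of_nat k)) = pochhammer (x + y) N / pochhammer x (Suc N)"
    unfolding r_def by (rule Suc.IH) (use ne in blast)
  have ne': "- of_nat (Suc N) + of_nat k \<noteq> (0::'a)" if "k \<le> N" for k
  proof -
    have "(of_nat k :: 'a) \<noteq> of_nat (Suc N)" using that by (metis Suc_n_not_le_n of_nat_eq_iff)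
    then show ?thesis unfolding add_eq_0_iff minus_minus .
  qed
  \<comment> \<open>The hypothesis at x = -(N+1) evaluates the sum of the contributions to the new
    pole; \<open>last\<close> identifies it, up to the factor y - 1, with the new residue.\<close>
  have IH': "(\<Sum>k\<le>N. r N k / (- of_nat (Suc N) + of_nat k)) =
      pochhammer (- of_nat (Suc N) + y) N / pochhammer (- of_nat (Suc N)) (Suc N)"
    unfolding r_def by (rule Suc.IH) (use ne' in blast)
  have step: "r N k / (x + of_nat k) * (x + y + of_nat N) / w =
      r (Suc N) k / (x + of_nat k) + (y - 1) / w * (r N k / (- of_nat (Suc N) + of_nat k))"
    if k: "k \<le> N" for k
  proof -
    \<comment> \<open>The distance between the old pole -k and the new pole -(N+1), the denominator
      that arises on splitting their product.\<close>
    define d where "d = (of_nat (Suc N - k) :: 'a)"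
    define v where "v = x + of_nat k"
    have d: "d \<noteq> 0" unfolding d_def of_nat_eq_0_iff using k by simp
    have v: "v \<noteq> 0" using ne[OF k] by (simp add: v_def)
    have N: "of_nat N = d + of_nat k - 1" using k by (simp add: d_def of_nat_diff)
    have wv: "w = v + d" using k by (simp add: w_def v_def d_def of_nat_diff)
    have "fact (Suc N - k) = d * fact (N - k)"
      using k by (simp add: d_def Suc_diff_le)
    moreover have "y - of_nat k + of_nat N = y + d - 1" by (simp add: N)
    ultimately have r: "r (Suc N) k = r N k * ((y + d - 1) / d)"
      unfolding r_def pochhammer_Suc by (simp only:) (simp add: mult_ac)
    have e: "- of_nat (Suc N) + of_nat k = - d" "x + y + of_nat N = v + y + d - 1"
      by (simp_all add: N v_def)
    have "v + d \<noteq> 0" using w wv by simp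
    have split: "R / v * (v + y + d - 1) / (v + d) = R * ((y + d - 1) / d) / v + (y - 1) / (v + d) * (R / - d)"
      for R
    proof -
      note vd = \<open>v + d \<noteq> 0\<close>
      have "(y + d - 1) * (v + d) - (y - 1) * v = d * (v + y + d - 1)" by (simp add: algebra_simps)
      then have "R * (d * (v + y + d - 1)) / (d * v * (v + d)) =
          R * ((y + d - 1) * (v + d) - (y - 1) * v) / (d * v * (v + d))" by (simp only:)
      also have "\<dots> = R * ((y + d - 1) * (v + d)) / (d * v * (v + d)) - R * ((y - 1) * v) / (d * v * (v + d))"
        by (simp only: right_diff_distrib diff_divide_distrib)
      also have "R * ((y + d - 1) * (v + d)) / (d * v * (v + d)) = R * ((y + d - 1) / d) / v"
        using vd by simp
      also have "R * ((y - 1) * v) / (d * v * (v + d)) = (y - 1) / (v + d) * (R / d)"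
        using v by (simp add: mult_ac)
      also have "R * (d * (v + y + d - 1)) / (d * v * (v + d)) = R / v * (v + y + d - 1) / (v + d)"
        using d by (simp add: mult_ac)
      finally show ?thesis by simp
    qed
    show ?thesis unfolding r v_def[symmetric] wv e by (rule split)
  qed
  have last: "r (Suc N) (Suc N) = (y - 1) * (\<Sum>k\<le>N. r N k / (- of_nat (Suc N) + of_nat k))"
  proof -
    have "r (Suc N) (Suc N) = (y - 1) * (pochhammer (y - of_nat (Suc N)) N / ((- 1) ^ Suc N * fact (Suc N)))"
    proof -
      have sgn: "(- 1) ^ m * u / v = u / ((- 1) ^ m * v)" for m and u v :: 'a
        by (cases "even m") auto
      have "y - of_nat (Suc N) + of_nat N = y - 1" by simp
      then show ?thesis unfolding r_def pochhammer_Suc[of _ N] sgn by (simp only:) (simp add: mult_ac)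
    qed
    also have "(- 1) ^ Suc N * fact (Suc N) = pochhammer (- of_nat (Suc N) :: 'a) (Suc N)"
      by (rule pochhammer_same[symmetric])
    also have "y - of_nat (Suc N) = - of_nat (Suc N) + y" by simp
    finally show ?thesis unfolding IH' .
  qed
  have "pochhammer (x + y) (Suc N) / pochhammer x (Suc (Suc N)) =
      pochhammer (x + y) N / pochhammer x (Suc N) * (x + y + of_nat N) / w"
    by (simp add: pochhammer_Suc[of "x + y" N] pochhammer_Suc[of x "Suc N"] w_def)
  also have "\<dots> = (\<Sum>k\<le>N. r N k / (x + of_nat k) * (x + y + of_nat N) / w)"
    unfolding IH[symmetric] by (simp add: sum_distrib_right sum_divide_distrib)
  also have "\<dots> = (\<Sum>k\<le>N. r (Suc N) k / (x + of_nat k)) +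
      (y - 1) / w * (\<Sum>k\<le>N. r N k / (- of_nat (Suc N) + of_nat k))"
    unfolding sum_distrib_left sum.distrib[symmetric] by (intro sum.cong refl step) simp
  also have "(y - 1) / w * (\<Sum>k\<le>N. r N k / (- of_nat (Suc N) + of_nat k)) = r (Suc N) (Suc N) / w"
    unfolding last by simp
  finally show ?case by (simp add: r_def w_def)
qed

lemma pochhammer_quotient_tendsto_Beta:
  fixes x :: complex and y :: real
  assumes "x \<notin> \<int>\<^sub>\<le>\<^sub>0" "0 < y"
  shows "(\<lambda>N. fact N * pochhammer (x + of_real y) N / (pochhammer x (Suc N) * pochhammer (of_real y) N))
           \<longlonglongrightarrow> Beta x (of_real y)"
proof -
  \<comment> \<open>Euler's limits for Gamma(x), Gamma(y) and 1/Gamma(x+y): the powers of N cancel,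
    and the last factor, tending to 1, adjusts two Pochhammer symbols from length N + 1 to
    N.\<close>
  have "(\<lambda>N. Gamma_series x N * Gamma_series (of_real y) N * rGamma_series (x + of_real y) N *
      ((of_real y + of_nat N) / (x + of_real y + of_nat N)))
      \<longlonglongrightarrow> Gamma x * Gamma (of_real y) * rGamma (x + of_real y) * 1"
    by (intro tendsto_mult tendsto_of_nat_plus_ratio Gamma_series_LIMSEQ rGamma_series_LIMSEQ)
  moreover have "eventually (\<lambda>N. Gamma_series x N * Gamma_series (of_real y) N * rGamma_series (x + of_real y) N *
      ((of_real y + of_nat N) / (x + of_real y + of_nat N)) =
      fact N * pochhammer (x + of_real y) N / (pochhammer x (Suc N) * pochhammer (of_real y) N)) sequentially"
    \<comment> \<open>Large N excludes x + y + N = 0; x + y may be a nonpositive integer.\<close>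
    using eventually_gt_at_top[of "nat \<lceil>norm (x + of_real y)\<rceil>"]
  proof eventually_elim
    case (elim N)
    define L where "L = complex_of_real (ln (of_nat N))"
    have "norm (x + of_real y) < real N" using elim by linarith
    then have "norm (x + of_real y) \<noteq> norm (- of_nat N :: complex)" by simp
    then have s: "x + of_real y + of_nat N \<noteq> 0" by (metis add_eq_0_iff2)
    have y: "complex_of_real y + of_nat N \<noteq> 0"
      using assms(2) by (metis add_pos_nonneg less_numeral_extra(3) of_nat_0_le_iff of_real_add of_real_eq_0_iff of_real_of_nat_eq)
    have e: "exp ((x + of_real y) * L) = exp (x * L) * exp (of_real y * L)"
      by (simp add: distrib_right exp_add)
    show ?case
      unfolding Gamma_series_def rGamma_series_def L_def[symmetric] e Suc_eq_plus1[symmetric]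
        pochhammer_Suc[of "x + of_real y" N] pochhammer_Suc[of "of_real y" N]
      using s y by simp
  qed
  ultimately show ?thesis by (simp add: Beta_altdef tendsto_cong)
qed

lemma tendsto_pochhammer_fact_ratio:
  fixes y :: real
  assumes "0 < y"
  shows "(\<lambda>n. (pochhammer y n / fact n) / (pochhammer y (n + k) / fact (n + k))) \<longlonglongrightarrow> 1"
proof (induction k)
  case 0
  have "pochhammer y n \<noteq> 0" for n using pochhammer_pos[OF assms, of n] by simp
  then show ?case by simp
next
  case (Suc k)
  have pos: "pochhammer y n > 0" for n by (rule pochhammer_pos[OF assms])
  have "(\<lambda>n::nat. (real n + real k + 1) / (y + real n + real k)) \<longlonglongrightarrow> 1" by real_asymp
  from tendsto_mult[OF Suc.IH this] have "(\<lambda>n. (pochhammer y n / fact n) / (pochhammer y (n + k) / fact (n + k)) *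
      ((real n + real k + 1) / (y + real n + real k))) \<longlonglongrightarrow> 1" by simp
  also have "(\<lambda>n. (pochhammer y n / fact n) / (pochhammer y (n + k) / fact (n + k)) *
      ((real n + real k + 1) / (y + real n + real k))) =
      (\<lambda>n. (pochhammer y n / fact n) / (pochhammer y (n + Suc k) / fact (n + Suc k)))"
  proof
    fix n
    have "y + real n + real k \<noteq> 0" using assms by linarith
    moreover have "pochhammer y (n + k) \<noteq> 0" using pos[of "n + k"] by simp
    moreover have "fact (Suc (n + k)) = (real n + real k + 1) * fact (n + k)" by (simp add: fact_Suc algebra_simps)
    moreover have "real n + real k + 1 \<noteq> 0" by linarith
    ultimately show "(pochhammer y n / fact n) / (pochhammer y (n + k) / fact (n + k)) *
      ((real n + real k + 1) / (y + real n + real k)) =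
      (pochhammer y n / fact n) / (pochhammer y (n + Suc k) / fact (n + Suc k))"
      by (simp add: pochhammer_Suc add.assoc[symmetric] mult_ac)
  qed
  finally show ?case .
qed

text \<open>Bounds the weights q(N-k)/q(N) in the Beta summation by 1, which makes the majorant
  there independent of N.\<close>

lemma pochhammer_fact_mono:
  fixes y :: real
  assumes "1 \<le> y" "m \<le> n"
  shows "pochhammer y m / fact m \<le> pochhammer y n / fact n"
  using assms(2)
proof (induction n rule: dec_induct)
  case (step n)
  have "pochhammer y n / fact n * 1 \<le> pochhammer y n / fact n * ((y + real n) / real (Suc n))"
    using assms(1) pochhammer_pos[of y n] by (intro mult_left_mono) auto
  also have "\<dots> = pochhammer y (Suc n) / fact (Suc n)"
    by (simp add: pochhammer_Suc fact_Suc)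
  finally show ?case using step.IH by simp
qed simp

text \<open>
  This is Gauss's summation of ${}_2F_1(1-y, x; x+1; 1)$. The partial fraction expansion of
  $(x+y)_N / (x)_{N+1}$, multiplied by $N!/(y)_N$, tends termwise to the series below.
\<close>

lemma sums_pochhammer_Beta:
  fixes x :: complex and y :: real
  assumes x: "x \<notin> \<int>\<^sub>\<le>\<^sub>0" and y: "1 \<le> y"
    and sm: "summable (\<lambda>k. \<bar>pochhammer (1 - y) k / fact k\<bar>)"
  shows "(\<lambda>k. of_real (pochhammer (1 - y) k / fact k) / (of_nat k + x)) sums Beta x (of_real y)"
proof -
  define e where "e = (\<lambda>k. pochhammer (1 - y) k / fact k)"
  define q where "q = (\<lambda>n. pochhammer y n / fact n)"
  have q_pos: "0 < q n" for n using y pochhammer_pos[of y n] by (simp add: q_def)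
  define a where "a = (\<lambda>k N. if k \<le> N then of_real (e k * (q (N - k) / q N)) / (of_nat k + x) else 0)"
  from norm_inverse_of_nat_plus_le[OF x] obtain B where
    B: "B > 0" "\<And>n. norm (1 / (of_nat n + x)) \<le> B / real (Suc n)" by blast
  have a_bound: "norm (a k N) \<le> \<bar>e k\<bar> * B" for k N
  proof (cases "k \<le> N")
    case True
    have "q (N - k) \<le> q N" unfolding q_def by (rule pochhammer_fact_mono[OF y]) simp
    then have "q (N - k) / q N \<le> 1" using q_pos[of N] by (simp add: divide_le_eq_1_pos)
    moreover have "0 \<le> q (N - k) / q N" using q_pos by (simp add: less_imp_le)
    ultimately have 1: "\<bar>e k * (q (N - k) / q N)\<bar> \<le> \<bar>e k\<bar> * 1"
      unfolding abs_mult by (intro mult_left_mono) auto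
    have 2: "norm (1 / (of_nat k + x)) \<le> B"
      using order_trans[OF B(2)[of k]] B(1) by (simp add: field_simps)
    have "norm (a k N) = \<bar>e k * (q (N - k) / q N)\<bar> * norm (1 / (of_nat k + x))"
      using True unfolding a_def by (simp only: if_True norm_divide norm_of_real norm_one) simp
    also have "\<dots> \<le> (\<bar>e k\<bar> * 1) * B" by (intro mult_mono 1 2) auto
    finally show ?thesis by simp
  qed (use B in \<open>simp add: a_def\<close>)
  have a_lim: "(\<lambda>N. a k N) \<longlonglongrightarrow> of_real (e k) / (of_nat k + x)" for k
  proof (rule LIMSEQ_offset[of _ k])
    have "(\<lambda>n. q n / q (n + k)) \<longlonglongrightarrow> 1"
      unfolding q_def using y by (intro tendsto_pochhammer_fact_ratio) simp
    then have "(\<lambda>n. of_real (e k * (q n / q (n + k))) / (of_nat k + x)) \<longlonglongrightarrow> of_real (e k * 1) / (of_nat k + x)"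
      using of_nat_plus_nonzero[OF x] by (intro tendsto_divide tendsto_of_real tendsto_mult tendsto_const) auto
    then show "(\<lambda>n. a k (n + k)) \<longlonglongrightarrow> of_real (e k) / (of_nat k + x)"
      by (simp add: a_def)
  qed
  have a_sum: "(\<Sum>k. a k N) = fact N * pochhammer (x + of_real y) N / (pochhammer x (Suc N) * pochhammer (of_real y) N)" for N
  proof -
    have term_eq: "a k N = fact N / pochhammer (of_real y) N *
        ((-1) ^ k * pochhammer (of_real y - of_nat k) N / (fact k * fact (N - k)) / (x + of_nat k))"
      if k: "k \<le> N" for k
    proof -
      \<comment> \<open>The product (y-k)_N splits after k factors; reflecting the first block gives
        (-1)^k (1-y)_k, and the rest is (y)_{N-k}.\<close>
      have "pochhammer (1 - y) k = (-1) ^ k * pochhammer (y - real k) k"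
        using pochhammer_minus[of "y - 1" k] by simp
      moreover have "pochhammer (y - real k) N = pochhammer (y - real k) k * pochhammer y (N - k)"
        using pochhammer_product[OF k, of "y - real k"] by simp
      ultimately have "(-1) ^ k * pochhammer (y - real k) N = pochhammer (1 - y) k * pochhammer y (N - k)"
        by simp
      then have "e k * (q (N - k) / q N) = fact N / pochhammer y N * ((-1) ^ k * pochhammer (y - real k) N / (fact k * fact (N - k)))"
        unfolding e_def q_def by (simp only:) (simp add: mult_ac)
      then have "complex_of_real (e k * (q (N - k) / q N)) = of_real (fact N / pochhammer y N * ((-1) ^ k * pochhammer (y - real k) N / (fact k * fact (N - k))))"
        by (simp only:)
      also have "\<dots> = fact N / pochhammer (of_real y) N * ((-1) ^ k * pochhammer (of_real y - of_nat k) N / (fact k * fact (N - k)))"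
      proof -
        have "complex_of_real (pochhammer w n) = pochhammer (of_real w) n" for w n
          by (rule pochhammer_of_real[symmetric])
        then show ?thesis by simp
      qed
      finally show ?thesis using k by (simp add: a_def add.commute)
    qed
    have "(\<Sum>k. a k N) = (\<Sum>k\<le>N. a k N)" by (rule suminf_finite) (auto simp: a_def)
    also have "\<dots> = fact N / pochhammer (of_real y) N *
        (\<Sum>k\<le>N. (-1) ^ k * pochhammer (of_real y - of_nat k) N / (fact k * fact (N - k)) / (x + of_nat k))"
      unfolding sum_distrib_left by (intro sum.cong refl term_eq) simp
    also have "(\<Sum>k\<le>N. (-1) ^ k * pochhammer (of_real y - of_nat k) N / (fact k * fact (N - k)) / (x + of_nat k)) =
        pochhammer (x + of_real y) N / pochhammer x (Suc N)"
      by (rule pochhammer_quotient_partial_fractions) (metis add.commute of_nat_plus_nonzero[OF x])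
    finally show ?thesis by (simp add: mult.commute)
  qed
  have sM: "summable (\<lambda>k. \<bar>e k\<bar> * B)" using sm unfolding e_def by (rule summable_mult2)
  have "(\<lambda>N. \<Sum>k. a k N) \<longlonglongrightarrow> (\<Sum>k. of_real (e k) / (of_nat k + x))"
    using tannerys_theorem[OF a_lim _ sM sequentially_bot] a_bound by (simp add: always_eventually)
  with pochhammer_quotient_tendsto_Beta[OF x, of y] y
  have "(\<Sum>k. of_real (e k) / (of_nat k + x)) = Beta x (of_real y)"
    unfolding a_sum by (intro LIMSEQ_unique) auto
  moreover have "summable (\<lambda>k. of_real (e k) / (of_nat k + x))"
  proof (rule summable_comparison_test'[OF sM])
    fix k
    show "norm (of_real (e k) / (of_nat k + x)) \<le> \<bar>e k\<bar> * B"
      using a_bound[of k k] tendsto_upperbound[OF tendsto_norm[OF a_lim[of k]], of "\<bar>e k\<bar> * B"] a_bound by simp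
  qed
  ultimately show ?thesis by (simp add: e_def sums_iff)
qed

section \<open>Identification of the series with the product\<close>

lemma pcd0_of_even: "pcd0 (of_nat (2 * k)) / fact (2 * k) = (- 1) ^ k / (2 ^ k * fact k)"
proof (induction k)
  case 0
  have "pcd0 0 = of_real (sqrt pi) * rGamma (1 / 2)" by (simp add: pcd0_def)
  also have "\<dots> = 1" by (simp add: rGamma_inverse_Gamma Gamma_one_half_complex)
  finally show ?case by simp
next
  case (Suc k)
  have "pcd0 (of_nat (2 * Suc k)) = - of_nat (Suc (2 * k)) * pcd0 (of_nat (2 * k))"
    using pcd0_plus1[of "of_nat (Suc (2 * k))"] by (simp add: add_ac)
  moreover have "fact (2 * Suc k) = of_nat (Suc (2 * k)) * (2 * of_nat (Suc k) * (fact (2 * k) :: complex))"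
    by (simp add: fact_Suc algebra_simps)
  ultimately have "pcd0 (of_nat (2 * Suc k)) / fact (2 * Suc k) =
      - (pcd0 (of_nat (2 * k)) / fact (2 * k)) / (2 * of_nat (Suc k))"
    by (simp del: of_nat_Suc)
  then show ?case unfolding Suc.IH by (simp add: mult_ac del: of_nat_Suc)
qed

lemma pcd0_of_odd: "pcd0 (of_nat (Suc (2 * k))) = 0"
proof -
  have "(1 - of_nat (Suc (2 * k))) / 2 = - (of_nat k :: complex)" by simp
  then show ?thesis unfolding pcd0_def by (simp only:) (simp add: rGamma_nonpos_Int)
qed

lemma pcd0_shift_even:
  "pcd0 (a + of_nat (2 * k)) = (- 2) ^ k * pochhammer ((a + 1) / 2) k * pcd0 a"
proof (induction k)
  case (Suc k)
  have "pcd0 (a + of_nat (2 * Suc k)) = - (a + of_nat (2 * k) + 1) * pcd0 (a + of_nat (2 * k))"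
    using pcd0_plus1[of "a + of_nat (2 * k) + 1"] by (simp add: add_ac)
  also have "- (a + of_nat (2 * k) + 1) = (- 2) * ((a + 1) / 2 + of_nat k)" by (simp add: field_simps)
  finally show ?case unfolding Suc.IH power_Suc pochhammer_Suc by (simp only: ac_simps)
qed simp

text \<open>The signs and powers of 2 of the two factors cancel, so with y = 1 - \<mu>/2 these are
  the numerators (1-y)_k/k! of Gauss's series; odd terms vanish because D_n(0) = 0.\<close>

lemma pcd_term_even_at_0:
  "pcd_term \<mu> (2 * k) 0 = pcd0 (of_real \<mu> - 1) * of_real (pochhammer (\<mu> / 2) k / fact k)"
proof -
  have "pcd_term \<mu> (2 * k) 0 = pcd0 (of_nat (2 * k)) / fact (2 * k) * pcd0 (of_real \<mu> - 1 + of_nat (2 * k))"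
    by (simp add: pcd_term_def add_ac diff_add_eq)
  also have "\<dots> = (- 1) ^ k * (- 2) ^ k / 2 ^ k * pochhammer (of_real \<mu> / 2) k / fact k * pcd0 (of_real \<mu> - 1)"
    unfolding pcd0_of_even pcd0_shift_even by simp
  also have "(- 1) ^ k * (- 2) ^ k / 2 ^ k = (1 :: complex)"
    by (simp add: power_mult_distrib[symmetric] power_divide[symmetric])
  also have "pochhammer (complex_of_real \<mu> / 2) k = of_real (pochhammer (\<mu> / 2) k)"
    by (simp add: pochhammer_of_real[symmetric])
  finally show ?thesis by simp
qed

lemma pcd_term_odd_at_0:
  assumes "n \<notin> range (\<lambda>k. 2 * k)"
  shows "pcd_term \<mu> n 0 = 0"
proof -
  from assms have "odd n" by (auto elim!: evenE)
  then obtain k where "n = Suc (2 * k)" by (auto elim!: oddE)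
  then show ?thesis
    unfolding pcd_term_def of_real_0 parabolic_cylinder_D_at_0 by (simp only: pcd0_of_odd) simp
qed

definition pcd_product :: "complex \<Rightarrow> real \<Rightarrow> real \<Rightarrow> complex" where
  "pcd_product \<nu> \<mu> t = Gamma \<nu> * (parabolic_cylinder_D (- \<nu>) (- of_real t) *
     parabolic_cylinder_D (of_real \<mu> - \<nu> - 1) (of_real t))"

lemma pcd_series_eq_product_at_0:
  assumes \<mu>: "\<mu> < 0" and \<nu>: "\<nu> \<notin> \<int>\<^sub>\<le>\<^sub>0"
  shows "pcd_series \<nu> \<mu> 0 = pcd_product \<nu> \<mu> 0"
proof -
  define y where "y = 1 - \<mu> / 2"
  have y: "1 \<le> y" "0 < y" using \<mu> by (simp_all add: y_def)
  have half: "\<nu> / 2 \<notin> \<int>\<^sub>\<le>\<^sub>0" "\<nu> / 2 + 1 / 2 \<notin> \<int>\<^sub>\<le>\<^sub>0"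
  proof -
    show "\<nu> / 2 \<notin> \<int>\<^sub>\<le>\<^sub>0"
    proof
      assume "\<nu> / 2 \<in> \<int>\<^sub>\<le>\<^sub>0"
      then obtain n where "\<nu> / 2 = - of_nat n" by (elim nonpos_Ints_cases')
      then have "\<nu> = - of_nat (2 * n)" by (simp add: field_simps)
      with \<nu> show False by (metis minus_of_nat_in_nonpos_Ints)
    qed
    show "\<nu> / 2 + 1 / 2 \<notin> \<int>\<^sub>\<le>\<^sub>0"
    proof
      assume "\<nu> / 2 + 1 / 2 \<in> \<int>\<^sub>\<le>\<^sub>0"
      then obtain n where "\<nu> / 2 + 1 / 2 = - of_nat n" by (elim nonpos_Ints_cases')
      then have "(\<nu> / 2 + 1 / 2) * 2 = - of_nat n * 2" by (simp only:)
      then have "\<nu> = - of_nat (2 * n + 1)" by (simp add: algebra_simps eq_neg_iff_add_eq_0)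
      with \<nu> show False by (metis minus_of_nat_in_nonpos_Ints)
    qed
  qed
  have G1: "Gamma (complex_of_real y) \<noteq> 0"
    using y(2) by (simp add: Gamma_complex_of_real Gamma_real_pos less_imp_neq[symmetric])
  have pcd0_\<mu>: "pcd0 (of_real \<mu> - 1) = 2 powr ((of_real \<mu> - 1) / 2) * of_real (sqrt pi) * rGamma (of_real y)"
    by (simp add: pcd0_def y_def field_simps)
  have nz: "pcd0 (of_real \<mu> - 1) \<noteq> 0"
    unfolding pcd0_\<mu> using G1 by (simp add: rGamma_inverse_Gamma)
  \<comment> \<open>The energy estimate supplies the absolute convergence that the Beta summation
    demands: the even terms at 0 are a nonzero multiple of its coefficients.\<close>
  have "summable (\<lambda>k. norm (pcd_term \<mu> (2 * k) 0))"
    using summable_norm_pcd_term[OF \<mu>, of 0]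
    by (subst summable_mono_reindex[of "\<lambda>k. 2 * k" "\<lambda>n. norm (pcd_term \<mu> n 0)"])
       (auto simp: strict_mono_def pcd_term_odd_at_0)
  then have "summable (\<lambda>k. norm (pcd0 (of_real \<mu> - 1)) * \<bar>pochhammer (\<mu> / 2) k / fact k\<bar>)"
    unfolding pcd_term_even_at_0 by (simp only: norm_mult norm_of_real)
  then have sm: "summable (\<lambda>k. \<bar>pochhammer (1 - y) k / fact k\<bar>)"
    using nz unfolding summable_cmult_iff by (simp add: y_def)
  have "(\<lambda>k. pcd0 (of_real \<mu> - 1) / 2 * (of_real (pochhammer (1 - y) k / fact k) / (of_nat k + \<nu> / 2)))
      sums (pcd0 (of_real \<mu> - 1) / 2 * Beta (\<nu> / 2) (of_real y))"
    by (intro sums_mult sums_pochhammer_Beta half y sm)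
  also have "(\<lambda>k. pcd0 (of_real \<mu> - 1) / 2 * (of_real (pochhammer (1 - y) k / fact k) / (of_nat k + \<nu> / 2)))
      = (\<lambda>k. pcd_term \<mu> (2 * k) 0 / (of_nat (2 * k) + \<nu>))"
  proof
    fix k
    have "of_nat (2 * k) + \<nu> = 2 * (of_nat k + \<nu> / 2)" by simp
    moreover have "1 - y = \<mu> / 2" by (simp add: y_def)
    ultimately show "pcd0 (of_real \<mu> - 1) / 2 * (of_real (pochhammer (1 - y) k / fact k) / (of_nat k + \<nu> / 2)) =
        pcd_term \<mu> (2 * k) 0 / (of_nat (2 * k) + \<nu>)"
      unfolding pcd_term_even_at_0 by (simp only: times_divide_times_eq)
  qed
  finally have "(\<lambda>n. pcd_term \<mu> n 0 / (of_nat n + \<nu>)) sums (pcd0 (of_real \<mu> - 1) / 2 * Beta (\<nu> / 2) (of_real y))"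
    by (subst (asm) sums_mono_reindex[where g = "\<lambda>k. 2 * k" and f = "\<lambda>n. pcd_term \<mu> n 0 / (of_nat n + \<nu>)"])
       (auto simp: strict_mono_def pcd_term_odd_at_0)
  moreover have "\<dots> = pcd_product \<nu> \<mu> 0"
  proof -
    define c where "c = complex_of_real (sqrt pi)"
    define p where "p = (\<lambda>w::complex. 2 powr w :: complex)"
    have c: "c * c = of_real pi" unfolding c_def by (simp flip: of_real_mult)
    \<comment> \<open>Duplication merges Gamma(\<nu>) with the factor 1/Gamma((\<nu>+1)/2) of
      D_{-\<nu>}(0) into the Gamma(\<nu>/2) of the Beta value; only powers of 2 then remain to be
      compared.\<close>
    have dup: "Gamma (\<nu> / 2) * Gamma (\<nu> / 2 + 1 / 2) = p (1 - \<nu>) * c * Gamma \<nu>"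
      using Gamma_legendre_duplication[OF half] by (simp add: p_def c_def powr_def Ln_of_real[symmetric] mult_ac)
    have pp: "p u * p v = p (u + v)" for u v by (simp add: p_def powr_add)
    have p2: "p 1 = 2" by (simp add: p_def)
    have h2: "Gamma (\<nu> / 2 + 1 / 2) \<noteq> 0" using half(2) by (simp add: Gamma_eq_zero_iff)
    have "pcd_product \<nu> \<mu> 0 = Gamma \<nu> * (p (- \<nu> / 2) * c * rGamma (\<nu> / 2 + 1 / 2)) *
        (p ((of_real \<mu> - \<nu> - 1) / 2) * c * rGamma (\<nu> / 2 + of_real y))"
      by (simp add: pcd_product_def pcd0_def p_def c_def y_def field_simps)
    also have "\<dots> = (p (1 - \<nu>) * c * Gamma \<nu>) * rGamma (\<nu> / 2 + 1 / 2) *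
        (p (- \<nu> / 2 + (of_real \<mu> - \<nu> - 1) / 2 - (1 - \<nu>)) * c * rGamma (\<nu> / 2 + of_real y))"
    proof -
      have "p (- \<nu> / 2) * p ((of_real \<mu> - \<nu> - 1) / 2) =
          p (1 - \<nu>) * p (- \<nu> / 2 + (of_real \<mu> - \<nu> - 1) / 2 - (1 - \<nu>))"
        unfolding pp by simp
      then show ?thesis by (simp only: ac_simps) (simp add: mult_ac)
    qed
    also have "p (1 - \<nu>) * c * Gamma \<nu> * rGamma (\<nu> / 2 + 1 / 2) = Gamma (\<nu> / 2)"
      unfolding dup[symmetric] using h2 by (simp add: rGamma_inverse_Gamma)
    also have "- \<nu> / 2 + (of_real \<mu> - \<nu> - 1) / 2 - (1 - \<nu>) = (of_real \<mu> - 1) / 2 - 1"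
      by (simp add: field_simps)
    also have "p ((of_real \<mu> - 1) / 2 - 1) = p ((of_real \<mu> - 1) / 2) / 2"
      using pp[of "(of_real \<mu> - 1) / 2 - 1" 1] p2 by (simp add: field_simps)
    finally have "pcd_product \<nu> \<mu> 0 =
        Gamma (\<nu> / 2) * (p ((of_real \<mu> - 1) / 2) / 2 * c * rGamma (\<nu> / 2 + of_real y))" .
    then show ?thesis
      unfolding pcd0_\<mu> Beta_altdef using G1
      by (simp add: p_def c_def rGamma_inverse_Gamma)
  qed
  moreover have "(\<lambda>n. pcd_term \<mu> n 0 / (of_nat n + \<nu>)) sums pcd_series \<nu> \<mu> 0"
    using \<mu> \<nu> by (intro pcd_series_sums) auto
  ultimately show ?thesis using sums_unique2 by metis
qed

section \<open>The same relations for the product\<close>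

lemma Gamma_plus1_notin_nonpos_Ints: "(\<nu>::complex) \<notin> \<int>\<^sub>\<le>\<^sub>0 \<Longrightarrow> Gamma (\<nu> + 1) = \<nu> * Gamma \<nu>"
  by (rule Gamma_plus1) auto

text \<open>The cancellation is that of the single terms. The reflected argument turns the
  derivative factor -\<nu> into \<nu>, which the Gamma factor absorbs as Gamma(\<nu>+1).\<close>

lemma has_vector_derivative_pcd_product:
  assumes "\<nu> \<notin> \<int>\<^sub>\<le>\<^sub>0"
  shows "(pcd_product \<nu> \<mu> has_vector_derivative
           (pcd_product (\<nu> + 1) (\<mu> + 1) t - pcd_product \<nu> (\<mu> + 1) t)) (at t)"
proof -
  define b where "b = complex_of_real \<mu> - \<nu> - 1"
  let ?A = "\<lambda>a. parabolic_cylinder_D a (- complex_of_real t)"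
  let ?B = "\<lambda>a. parabolic_cylinder_D a (complex_of_real t)"
  have A: "((\<lambda>t. parabolic_cylinder_D (- \<nu>) (- complex_of_real t)) has_vector_derivative
      (\<nu> * ?A (- \<nu> - 1) - of_real t / 2 * ?A (- \<nu>))) (at t)"
  proof -
    have "((\<lambda>z. parabolic_cylinder_D (- \<nu>) (- z)) has_field_derivative
       (\<nu> * ?A (- \<nu> - 1) - of_real t / 2 * ?A (- \<nu>))) (at (of_real t))"
      using has_field_derivative_parabolic_cylinder_D[of "- \<nu>" "- of_real t"]
      by (auto dest!: DERIV_chain2[where g = uminus and x = "complex_of_real t" and s = UNIV]
               intro!: derivative_eq_intros DERIV_chain2[OF has_field_derivative_parabolic_cylinder_D])
    then show ?thesis by (rule has_vector_derivative_real_field)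
  qed
  have rec: "b * ?B (b - 1) = of_real t * ?B b - ?B (b + 1)"
    using parabolic_cylinder_D_plus1[of b "of_real t"] by simp
  have "((\<lambda>t. Gamma \<nu> * (parabolic_cylinder_D (- \<nu>) (- complex_of_real t) * parabolic_cylinder_D b (complex_of_real t)))
     has_vector_derivative Gamma \<nu> * (?A (- \<nu>) * (b * ?B (b - 1) - of_real t / 2 * ?B b) +
       (\<nu> * ?A (- \<nu> - 1) - of_real t / 2 * ?A (- \<nu>)) * ?B b)) (at t)"
    by (intro has_vector_derivative_mult_right has_vector_derivative_mult A has_vector_derivative_parabolic_cylinder_D)
  also have "Gamma \<nu> * (?A (- \<nu>) * (b * ?B (b - 1) - of_real t / 2 * ?B b) +
       (\<nu> * ?A (- \<nu> - 1) - of_real t / 2 * ?A (- \<nu>)) * ?B b) =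
       (\<nu> * Gamma \<nu>) * (?A (- \<nu> - 1) * ?B b) - Gamma \<nu> * (?A (- \<nu>) * ?B (b + 1))"
    unfolding rec by (simp add: field_simps)
  also have "(\<nu> * Gamma \<nu>) * (?A (- \<nu> - 1) * ?B b) = pcd_product (\<nu> + 1) (\<mu> + 1) t"
  proof -
    have "- (\<nu> + 1) = - \<nu> - 1" "complex_of_real (\<mu> + 1) - (\<nu> + 1) - 1 = b" by (simp_all add: b_def)
    then show ?thesis unfolding pcd_product_def Gamma_plus1_notin_nonpos_Ints[OF assms] by simp
  qed
  also have "Gamma \<nu> * (?A (- \<nu>) * ?B (b + 1)) = pcd_product \<nu> (\<mu> + 1) t"
    by (simp add: pcd_product_def b_def algebra_simps)
  finally show ?thesis unfolding pcd_product_def[abs_def] b_def .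
qed

lemma pcd_product_plus1:
  "pcd_product \<nu> (\<mu> + 1) t = of_real t * pcd_product \<nu> \<mu> t - (of_real \<mu> - 1 - \<nu>) * pcd_product \<nu> (\<mu> - 1) t"
proof -
  define b where "b = complex_of_real \<mu> - \<nu> - 1"
  have "complex_of_real (\<mu> + 1) - \<nu> - 1 = b + 1" "complex_of_real (\<mu> - 1) - \<nu> - 1 = b - 1"
    "complex_of_real \<mu> - 1 - \<nu> = b" "complex_of_real \<mu> - \<nu> - 1 = b"
    by (simp_all add: b_def)
  then show ?thesis
    unfolding pcd_product_def by (simp only: parabolic_cylinder_D_plus1) (simp add: algebra_simps)
qed

text \<open>The joint shift leaves \<mu> - \<nu> - 1, the index of the second factor, unchanged, so
  this is the recurrence for the first factor at -t.\<close>

lemma pcd_product_shift: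
  assumes "\<nu> \<notin> \<int>\<^sub>\<le>\<^sub>0"
  shows "pcd_product (\<nu> + 2) (\<mu> + 2) t = of_real t * pcd_product (\<nu> + 1) (\<mu> + 1) t + \<nu> * pcd_product \<nu> \<mu> t"
proof -
  define b where "b = complex_of_real \<mu> - \<nu> - 1"
  let ?A = "\<lambda>a. parabolic_cylinder_D a (- complex_of_real t)"
  have b: "complex_of_real (\<mu> + 2) - (\<nu> + 2) - 1 = b" "complex_of_real (\<mu> + 1) - (\<nu> + 1) - 1 = b"
    "complex_of_real \<mu> - \<nu> - 1 = b"
    by (simp_all add: b_def)
  have G1: "Gamma (\<nu> + 1) = \<nu> * Gamma \<nu>" by (rule Gamma_plus1_notin_nonpos_Ints[OF assms])
  have G2: "Gamma (\<nu> + 2) = (\<nu> + 1) * Gamma (\<nu> + 1)"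
    using Gamma_plus1_notin_nonpos_Ints[OF plus1_notin_nonpos_Ints[OF assms]] by (simp add: add.assoc)
  have rec: "(\<nu> + 1) * ?A (- (\<nu> + 2)) = of_real t * ?A (- (\<nu> + 1)) + ?A (- \<nu>)"
    using parabolic_cylinder_D_plus1[of "- (\<nu> + 1)" "- of_real t"] by (simp add: algebra_simps)
  have "pcd_product (\<nu> + 2) (\<mu> + 2) t = \<nu> * Gamma \<nu> * ((\<nu> + 1) * ?A (- (\<nu> + 2))) * parabolic_cylinder_D b (of_real t)"
    unfolding pcd_product_def b G2 G1 by (simp only: ac_simps)
  also have "\<dots> = of_real t * pcd_product (\<nu> + 1) (\<mu> + 1) t + \<nu> * pcd_product \<nu> \<mu> t"
    unfolding rec pcd_product_def b G1 by (simp add: algebra_simps)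
  finally show ?thesis .
qed

text \<open>Gronwall for the sum of the four squared norms, whose coefficients are bounded on each
  compact interval.\<close>

lemma linear_system_unique:
  fixes u v p q :: "real \<Rightarrow> complex" and \<beta> \<gamma> :: complex
  assumes u: "\<And>t. (u has_vector_derivative (p t - of_real t * u t + \<beta> * v t)) (at t)"
    and v: "\<And>t. (v has_vector_derivative (q t - u t)) (at t)"
    and p: "\<And>t. (p has_vector_derivative (\<gamma> * u t + \<beta> * q t)) (at t)"
    and q: "\<And>t. (q has_vector_derivative (of_real t * q t + \<gamma> * v t - p t)) (at t)"
    and 0: "u 0 = 0" "v 0 = 0" "p 0 = 0" "q 0 = 0"
  shows "u t = 0"
proof -
  define Z where "Z = \<bar>t\<bar>"
  define N where "N = (\<lambda>t. (norm (u t))\<^sup>2 + (norm (v t))\<^sup>2 + (norm (p t))\<^sup>2 + (norm (q t))\<^sup>2)"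
  define N' where "N' = (\<lambda>t. 2 * (u t \<bullet> (p t - of_real t * u t + \<beta> * v t)) + 2 * (v t \<bullet> (q t - u t)) +
     2 * (p t \<bullet> (\<gamma> * u t + \<beta> * q t)) + 2 * (q t \<bullet> (of_real t * q t + \<gamma> * v t - p t)))"
  define k where "k = 1 + Z + norm \<beta> + norm \<gamma>"
  have der: "(N has_real_derivative N' s) (at s)" for s
    unfolding N_def N'_def by (intro DERIV_add has_real_derivative_norm_square u v p q)
  have inner_bound: "\<bar>x \<bullet> (c * w)\<bar> \<le> norm c * N s"
    if "norm x \<le> sqrt (N s)" "norm w \<le> sqrt (N s)" for x w c :: complex and s
  proof -
    have nn: "0 \<le> N s" by (simp add: N_def)
    have "\<bar>x \<bullet> (c * w)\<bar> \<le> norm x * norm (c * w)" by (rule Cauchy_Schwarz_ineq2)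
    also have "\<dots> = norm c * (norm x * norm w)" by (simp add: norm_mult)
    also have "\<dots> \<le> norm c * (sqrt (N s) * sqrt (N s))"
      using that by (intro mult_left_mono mult_mono) (auto simp: nn)
    finally show ?thesis using nn by simp
  qed
  \<comment> \<open>N' consists of ten inner products, each with factor 2 and each at most k N;
    hence 20 k.\<close>
  have bound: "\<bar>N' s\<bar> \<le> (20 * k) * N s" if "\<bar>s\<bar> \<le> Z" for s
  proof -
    have n: "norm (u s) \<le> sqrt (N s)" "norm (v s) \<le> sqrt (N s)" "norm (p s) \<le> sqrt (N s)" "norm (q s) \<le> sqrt (N s)"
      by (rule real_le_rsqrt, simp add: N_def)+
    have nn: "0 \<le> N s" by (simp add: N_def)
    have ib: "\<bar>x \<bullet> (c * w)\<bar> \<le> k * N s"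
      if "norm x \<le> sqrt (N s)" "norm w \<le> sqrt (N s)" "norm c \<le> k" for x w c :: complex
      using inner_bound[OF that(1,2), of c] mult_right_mono[OF that(3) nn] by linarith
    have ib1: "\<bar>x \<bullet> w\<bar> \<le> k * N s"
      if "norm x \<le> sqrt (N s)" "norm w \<le> sqrt (N s)" for x w :: complex
      using ib[OF that, of 1] by (simp add: k_def Z_def)
    have c: "norm \<beta> \<le> k" "norm \<gamma> \<le> k" "norm (complex_of_real s) \<le> k"
      using that by (simp_all add: k_def Z_def add_nonneg_nonneg add_increasing add_increasing2)
    note bs = ib1[OF n(1) n(3)] ib[OF n(1) n(1) c(3)] ib[OF n(1) n(2) c(1)] ib1[OF n(2) n(4)] ib1[OF n(2) n(1)]
      ib[OF n(3) n(1) c(2)] ib[OF n(3) n(4) c(1)] ib[OF n(4) n(4) c(3)] ib[OF n(4) n(2) c(2)] ib1[OF n(4) n(3)]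
    show ?thesis
    proof -
      define K where "K = k * N s"
      have "20 * k * N s = 20 * K" by (simp add: K_def)
      then show ?thesis
        unfolding N'_def inner_add_right inner_diff_right distrib_left right_diff_distrib
        using bs[folded K_def, THEN abs_le_D1] bs[folded K_def, THEN abs_le_D2]
        by (intro abs_leI; linarith)
    qed
  qed
  have "N t \<le> N 0 * exp (20 * k * \<bar>t\<bar>)"
    by (rule gronwall_abs[OF der bound]) (auto simp: Z_def)
  then have "N t \<le> 0" by (simp add: N_def 0)
  then have "(norm (u t))\<^sup>2 \<le> 0" unfolding N_def by (smt (verit) zero_le_power2)
  then show ?thesis by simp
qed

lemma pcd_series_eq_product_aux:
  assumes \<mu>: "\<mu> < -1" and \<nu>: "\<nu> \<notin> \<int>\<^sub>\<le>\<^sub>0"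
  shows "pcd_series \<nu> \<mu> t = pcd_product \<nu> \<mu> t"
proof -
  \<comment> \<open>All relations are linear and homogeneous with equal coefficients on both sides,
    so the difference inherits them.\<close>
  define F where "F = (\<lambda>\<nu> \<mu> t. pcd_series \<nu> \<mu> t - pcd_product \<nu> \<mu> t)"
  have \<nu>1: "\<nu> + 1 \<notin> \<int>\<^sub>\<le>\<^sub>0" using \<nu> by (rule plus1_notin_nonpos_Ints)
  have der: "(F \<kappa> m has_vector_derivative (F (\<kappa> + 1) (m + 1) t - F \<kappa> (m + 1) t)) (at t)"
    if "m < 1" "\<kappa> \<notin> \<int>\<^sub>\<le>\<^sub>0" for \<kappa> m t
    using has_vector_derivative_diff[OF has_vector_derivative_pcd_series[OF that, of t]
        has_vector_derivative_pcd_product[OF that(2), of m t]]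
    by (simp add: F_def[abs_def] algebra_simps)
  have rec: "F \<kappa> (m + 1) t = of_real t * F \<kappa> m t - (of_real m - 1 - \<kappa>) * F \<kappa> (m - 1) t"
    if "m < 1" "\<kappa> \<notin> \<int>\<^sub>\<le>\<^sub>0" for \<kappa> m t
    using pcd_series_plus1[OF that, of t] pcd_product_plus1[of \<kappa> m t] by (simp add: F_def algebra_simps)
  have shift: "F (\<kappa> + 2) (m + 2) t = of_real t * F (\<kappa> + 1) (m + 1) t + \<kappa> * F \<kappa> m t"
    if "m < 0" "\<kappa> \<notin> \<int>\<^sub>\<le>\<^sub>0" for \<kappa> m t
    using pcd_series_shift[OF that, of t] pcd_product_shift[OF that(2), of m t] by (simp add: F_def algebra_simps)
  have zero: "F \<kappa> m 0 = 0" if "m < 0" "\<kappa> \<notin> \<int>\<^sub>\<le>\<^sub>0" for \<kappa> m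
    using pcd_series_eq_product_at_0[OF that] by (simp add: F_def)
  have "F \<nu> \<mu> t = 0"
  proof (rule linear_system_unique[where u = "F \<nu> \<mu>" and v = "F \<nu> (\<mu> - 1)" and p = "F (\<nu> + 1) (\<mu> + 1)"
        and q = "F (\<nu> + 1) \<mu>" and \<beta> = "of_real \<mu> - \<nu> - 1" and \<gamma> = \<nu>])
    fix t
    have "F (\<nu> + 1) (\<mu> + 1) t - F \<nu> (\<mu> + 1) t =
        F (\<nu> + 1) (\<mu> + 1) t - of_real t * F \<nu> \<mu> t + (of_real \<mu> - \<nu> - 1) * F \<nu> (\<mu> - 1) t"
      using rec[of \<mu> \<nu> t] \<mu> \<nu> by (simp add: algebra_simps)
    with der[of \<mu> \<nu> t] \<mu> \<nu>
    show "(F \<nu> \<mu> has_vector_derivative (F (\<nu> + 1) (\<mu> + 1) t - of_real t * F \<nu> \<mu> t +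
        (of_real \<mu> - \<nu> - 1) * F \<nu> (\<mu> - 1) t)) (at t)" by simp
    show "(F \<nu> (\<mu> - 1) has_vector_derivative (F (\<nu> + 1) \<mu> t - F \<nu> \<mu> t)) (at t)"
      using der[of "\<mu> - 1" \<nu> t] \<mu> \<nu> by simp
    have e: "\<nu> + 1 + 1 = \<nu> + 2" "\<mu> + 1 + 1 = \<mu> + 2" "\<mu> - 1 + 1 = \<mu>" "\<mu> - 1 + 2 = \<mu> + 1" "\<mu> + 1 - 1 = \<mu>"
      by simp_all
    have "F (\<nu> + 1) (\<mu> + 2) t = of_real t * F (\<nu> + 1) (\<mu> + 1) t - (of_real \<mu> - \<nu> - 1) * F (\<nu> + 1) \<mu> t"
      using rec[of "\<mu> + 1" "\<nu> + 1" t, unfolded e] \<mu> \<nu>1 by (simp add: algebra_simps)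
    then have "F (\<nu> + 2) (\<mu> + 2) t - F (\<nu> + 1) (\<mu> + 2) t =
        \<nu> * F \<nu> \<mu> t + (of_real \<mu> - \<nu> - 1) * F (\<nu> + 1) \<mu> t"
      using shift[of \<mu> \<nu> t] \<mu> \<nu> by simp
    with der[of "\<mu> + 1" "\<nu> + 1" t, unfolded e] \<mu> \<nu>1
    show "(F (\<nu> + 1) (\<mu> + 1) has_vector_derivative (\<nu> * F \<nu> \<mu> t + (of_real \<mu> - \<nu> - 1) * F (\<nu> + 1) \<mu> t)) (at t)"
      by simp
    have "F (\<nu> + 2) (\<mu> + 1) t - F (\<nu> + 1) (\<mu> + 1) t =
        of_real t * F (\<nu> + 1) \<mu> t + \<nu> * F \<nu> (\<mu> - 1) t - F (\<nu> + 1) (\<mu> + 1) t"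
      using shift[of "\<mu> - 1" \<nu> t, unfolded e] \<mu> \<nu> by simp
    with der[of \<mu> "\<nu> + 1" t, unfolded e] \<mu> \<nu>1
    show "(F (\<nu> + 1) \<mu> has_vector_derivative (of_real t * F (\<nu> + 1) \<mu> t + \<nu> * F \<nu> (\<mu> - 1) t - F (\<nu> + 1) (\<mu> + 1) t)) (at t)"
      by simp
  qed (use zero \<mu> \<nu> \<nu>1 in auto)
  then show ?thesis by (simp add: F_def)
qed

lemma pcd_series_eq_product:
  assumes "\<mu> < 2" and \<nu>: "\<nu> \<notin> \<int>\<^sub>\<le>\<^sub>0"
  shows "pcd_series \<nu> \<mu> t = pcd_product \<nu> \<mu> t"
proof -
  \<comment> \<open>Each step raises the bound on \<mu> by one and uses the identity at \<mu> - 1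
    and \<mu> - 2; k = 0 is the range \<mu> < -1.\<close>
  have "pcd_series \<nu> \<mu> t = pcd_product \<nu> \<mu> t" if "\<mu> < real k - 1" "\<mu> < 2" for k \<mu>
    using that
  proof (induction k arbitrary: \<mu>)
    case 0
    then show ?case using pcd_series_eq_product_aux[OF _ \<nu>] by simp
  next
    case (Suc k)
    have "pcd_series \<nu> (\<mu> - 1) t = pcd_product \<nu> (\<mu> - 1) t" "pcd_series \<nu> (\<mu> - 1 - 1) t = pcd_product \<nu> (\<mu> - 1 - 1) t"
      using Suc.prems by (intro Suc.IH; simp)+
    then show ?case
      using pcd_series_plus1[of "\<mu> - 1" \<nu> t] pcd_product_plus1[of \<nu> "\<mu> - 1" t] Suc.prems \<nu> by simp
  qed
  moreover obtain k :: nat where "\<mu> + 1 < real k" using reals_Archimedean2 by blast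
  ultimately show ?thesis using assms(1) by (metis less_diff_eq)
qed

section \<open>Nonpositive integers \<nu> and conclusion\<close>

lemma parabolic_cylinder_D_minus:
  "parabolic_cylinder_D (of_nat m) (- z) = (- 1) ^ m * parabolic_cylinder_D (of_nat m) z"
proof (cases "even m")
  case True
  then obtain k where "m = 2 * k" by (elim evenE)
  \<comment> \<open>The parity of m puts one of the two Gamma factors at a pole, leaving a single
    Kummer term with the same parity in the argument.\<close>
  then have "rGamma (- (of_nat m / 2)) = (0::complex)" by (simp add: rGamma_nonpos_Int)
  with True show ?thesis by (simp add: parabolic_cylinder_D_def)
next
  case False
  then obtain k where "m = 2 * k + 1" by (elim oddE)
  then have "1 / 2 - of_nat m / 2 = - (of_nat k :: complex)" by (simp add: field_simps)
  then have "rGamma (1 / 2 - of_nat m / 2) = (0::complex)" by (simp add: rGamma_nonpos_Int)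
  with False show ?thesis by (simp add: parabolic_cylinder_D_def)
qed

lemma gamma_coeff_minus_of_nat:
  "gamma_coeff (- of_nat m) n = (if n = m then (- 1) ^ m * fact m else 0)"
proof -
  have "((\<lambda>w. rGamma w / (of_nat n + w)) \<longlongrightarrow> (if n = m then (- 1) ^ m * fact m else 0)) (at (- of_nat m :: complex))"
  proof (cases "n = m")
    case True
    \<comment> \<open>Since 1/Gamma vanishes at -m, the coefficient is its difference quotient
      there, and the limit is the derivative.\<close>
    have "((\<lambda>w. (rGamma w - rGamma (- of_nat m)) / (w - - of_nat m)) \<longlongrightarrow> (- 1) ^ m * fact m) (at (- of_nat m :: complex))"
      using has_field_derivative_rGamma_nonpos_int[of m UNIV] by (simp add: has_field_derivative_iff)
    then show ?thesis using True by (simp add: rGamma_nonpos_Int add.commute)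
  next
    case False
    then have "of_nat n + (- of_nat m) \<noteq> (0 :: complex)" by simp
    moreover have "(rGamma \<longlongrightarrow> rGamma (- of_nat m)) (at (- of_nat m :: complex))"
      using DERIV_isCont[OF has_field_derivative_rGamma_nonpos_int[of m UNIV]] by (simp add: isCont_def)
    ultimately have "((\<lambda>w. rGamma w / (of_nat n + w)) \<longlongrightarrow> rGamma (- of_nat m) / (of_nat n + (- of_nat m))) (at (- of_nat m :: complex))"
      by (intro tendsto_intros)
    then show ?thesis using False by (simp add: rGamma_nonpos_Int)
  qed
  then show ?thesis by (simp add: gamma_coeff_def tendsto_Lim)
qed

theorem mainTheorem6:
  fixes \<nu> :: complex and \<mu> z :: real
  assumes "\<mu> < 3 / 2"
  shows "(\<lambda>n. gamma_coeff \<nu> n *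
              (parabolic_cylinder_D (of_nat n) (of_real z) *
               parabolic_cylinder_D (of_real \<mu> + of_nat n - 1) (of_real z) / fact n))
         sums (parabolic_cylinder_D (- \<nu>) (- of_real z) *
               parabolic_cylinder_D (of_real \<mu> - \<nu> - 1) (of_real z))"
proof (cases "\<nu> \<in> \<int>\<^sub>\<le>\<^sub>0")
  case True
  then obtain m where m: "\<nu> = - of_nat m" by (elim nonpos_Ints_cases')
  \<comment> \<open>Only n = m survives; its factorial cancels, and the sign (-1)^m turns D_m(z)
    into D_m(-z).\<close>
  have "(\<lambda>n. gamma_coeff \<nu> n * pcd_term \<mu> n z) sums (\<Sum>n\<in>{m}. gamma_coeff \<nu> n * pcd_term \<mu> n z)"
    by (rule sums_finite) (auto simp: m gamma_coeff_minus_of_nat)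
  also have "(\<Sum>n\<in>{m}. gamma_coeff \<nu> n * pcd_term \<mu> n z) =
      parabolic_cylinder_D (- \<nu>) (- of_real z) * parabolic_cylinder_D (of_real \<mu> - \<nu> - 1) (of_real z)"
    by (simp add: m gamma_coeff_minus_of_nat pcd_term_def parabolic_cylinder_D_minus)
  finally show ?thesis by (simp add: pcd_term_def)
next
  case False
  have \<mu>: "\<mu> < 2" using assms by simp
  have "(\<lambda>n. rGamma \<nu> * (pcd_term \<mu> n z / (of_nat n + \<nu>))) sums (rGamma \<nu> * pcd_product \<nu> \<mu> z)"
    using pcd_series_sums[OF \<mu> False, of z] unfolding pcd_series_eq_product[OF \<mu> False] by (rule sums_mult)
  also have "rGamma \<nu> * pcd_product \<nu> \<mu> z =
      parabolic_cylinder_D (- \<nu>) (- of_real z) * parabolic_cylinder_D (of_real \<mu> - \<nu> - 1) (of_real z)"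
    using False by (simp add: pcd_product_def rGamma_inverse_Gamma Gamma_eq_zero_iff)
  finally show ?thesis using False by (simp add: gamma_coeff_def pcd_term_def mult_ac)
qed

end
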